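(* Let $G_t$, $t=0,\dots,T$, be proper convex functions on $C_t$ and let $\hat u:S\to\mathbb R$ be upper semicontinuous. Consider the problems \[ \text{(A)}\quad \begin{aligned} &\text{minimize}&&\sum_{t=0}^TG_t(x_t)\quad\text{over }x\in\prod_{t=0}^TC_t,\ z\in\mathcal N\\ &\text{subject to}&&\hat u(s)\le\sum_{t=0}^{T-1}z_t(s^t)\cdot\Delta s_{t+1}+\sum_{t=0}^Tx_t(s_t)\quad\forall s\in S \end{aligned} \] and \[ \text{(B)}\quad\text{minimize}\quad\sum_{t=0}^TG_t^*(\lambda_t)-\int_S\hat u\,d\lambda\quad\text{over }\lambda\in\mathcal M . \] Assume that $\operatorname{dom}G_t^*\subset M_t$ for all $t=0,\dots,T$, that $\hat u\le K\psi$ for some $K\in\mathbb R$, and that (A) remains feasible when $\hat u$ is increased by $\epsilon\psi$ (i.e. replaced by $\hat u+\epsilon\psi$) for some $\epsilon>0$. Then the optimum in (B) is attained and its optimum value coincides with the negative of the optimum value of (A).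
   Context: $S_t=\mathbb R^n$ for $t=0,\dots,T$, $S=S_0\times\cdots\times S_T$, $S^t=S_0\times\cdots\times S_t$, $s^t=(s_0,\dots,s_t)$, $\Delta s_{t+1}=s_{t+1}-s_t$. $\psi_t(s_t)=1+|s_t|$ and $\psi(s)=\sum_{t=0}^T\psi_t(s_t)$. $C_t:=\{x_t\in C(S_t)\mid x_t/\psi_t\text{ bounded}\}$ (real-valued) is a Banach space with norm $\sup|x_t/\psi_t|$. $M_t$ (resp. $M$) is the space of finite signed Borel measures on $S_t$ (resp. $S$) under which $\psi_t$ (resp. $\psi$) is integrable, with $M_t\subseteq C_t^*$ through integration, and $M_+$ is the set of nonnegative elements of $M$. $\lambda_t$ is the $t$-th marginal of $\lambda$; $G_t^*$ is the convex conjugate of $G_t$ on $C_t^*$. $\mathcal N:=\{(z_t)_{t=0}^{T-1}\mid z_t\in\mathcal L^\infty(S^t;\mathbb R^n)\}$, where $\mathcal L^\infty(S^t;\mathbb R^n)$ is the space of bounded Borel measurable functions. The set of nonnegative martingale measures is \[ \mathcal M:=\Big\{\lambda\in M_+\ \Big|\ \int_S\sum_{t=0}^{T-1}z_t(s^t)\cdot\Delta s_{t+1}\,d\lambda=0\quad\forall z\in\mathcal N\Big\}. \] "Feasible" means that there are $x_t\in\operatorname{dom}G_t$ and $z\in\mathcal N$ satisfying the constraint. "Attained" means that some element of $\mathcal M$ has objective value equal to the infimum. *)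

theory Defs
  imports "HOL-Analysis.Analysis"
begin

section \<open>Continuous functions of at most linear growth\<close>

definition psi1 :: "'a::real_normed_vector \<Rightarrow> real" where
  "psi1 s = 1 + norm s"

lemma psi1_ge_1: "1 \<le> psi1 s"
  by (simp add: psi1_def)

lemma psi1_pos [simp]: "0 < psi1 s"
  using psi1_ge_1[of s] by linarith

lemma psi1_nonneg [simp]: "0 \<le> psi1 s"
  by (rule less_imp_le) simp

lemma psi1_nonzero [simp]: "psi1 s \<noteq> 0"
  using psi1_pos[of s] by linarith

typedef (overloaded) 'a::real_normed_vector lgfun =
    "{x :: 'a \<Rightarrow> real. continuous_on UNIV x \<and> bounded (range (\<lambda>s. x s / psi1 s))}"
  morphisms apply_lgfun Lgfun
  by (rule exI[of _ "\<lambda>_. 0"]) auto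

setup_lifting type_definition_lgfun

lemma continuous_apply_lgfun: "continuous_on UNIV (apply_lgfun x)"
  and bounded_apply_lgfun: "bounded (range (\<lambda>s. apply_lgfun x s / psi1 s))"
  using apply_lgfun[of x] by auto

lemma lgfun_eqI: "(\<And>s. apply_lgfun x s = apply_lgfun y s) \<Longrightarrow> x = y"
  by (simp add: apply_lgfun_inject[symmetric] ext)

instantiation lgfun :: (real_normed_vector) real_vector
begin

lift_definition zero_lgfun :: "'a lgfun" is "\<lambda>_. 0"
  by auto

lift_definition plus_lgfun :: "'a lgfun \<Rightarrow> 'a lgfun \<Rightarrow> 'a lgfun" is "\<lambda>x y s. x s + y s"
  by (auto intro!: continuous_intros bounded_plus_comp simp: add_divide_distrib)

lift_definition uminus_lgfun :: "'a lgfun \<Rightarrow> 'a lgfun" is "\<lambda>x s. - x s"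
  by (auto intro!: continuous_intros simp: bounded_iff)

lift_definition minus_lgfun :: "'a lgfun \<Rightarrow> 'a lgfun \<Rightarrow> 'a lgfun" is "\<lambda>x y s. x s - y s"
  by (auto intro!: continuous_intros bounded_minus_comp simp: diff_divide_distrib)

lift_definition scaleR_lgfun :: "real \<Rightarrow> 'a lgfun \<Rightarrow> 'a lgfun" is "\<lambda>c x s. c * x s"
proof -
  fix c :: real and x :: "'a \<Rightarrow> real"
  assume x: "continuous_on UNIV x \<and> bounded (range (\<lambda>s. x s / psi1 s))"
  have "bounded ((\<lambda>r. c *\<^sub>R r) ` range (\<lambda>s. x s / psi1 s))"
    using x by (intro bounded_scaling) auto
  then have "bounded (range (\<lambda>s. c * x s / psi1 s))"
    by (simp add: image_image)
  then show "continuous_on UNIV (\<lambda>s. c * x s) \<and> bounded (range (\<lambda>s. c * x s / psi1 s))"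
    using x by (auto intro!: continuous_intros)
qed

instance
  by standard (transfer; simp add: fun_eq_iff algebra_simps)+

end

lemma apply_lgfun_simps [simp]:
  "apply_lgfun 0 s = 0"
  "apply_lgfun (x + y) s = apply_lgfun x s + apply_lgfun y s"
  "apply_lgfun (- x) s = - apply_lgfun x s"
  "apply_lgfun (x - y) s = apply_lgfun x s - apply_lgfun y s"
  "apply_lgfun (c *\<^sub>R x) s = c * apply_lgfun x s"
  by (transfer; simp)+

instantiation lgfun :: (real_normed_vector) real_normed_vector
begin

definition norm_lgfun :: "'a lgfun \<Rightarrow> real" where
  "norm_lgfun x = (SUP s. \<bar>apply_lgfun x s / psi1 s\<bar>)"

definition dist_lgfun :: "'a lgfun \<Rightarrow> 'a lgfun \<Rightarrow> real" where
  "dist_lgfun x y = norm (x - y)"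

definition sgn_lgfun :: "'a lgfun \<Rightarrow> 'a lgfun" where
  "sgn_lgfun x = inverse (norm x) *\<^sub>R x"

definition uniformity_lgfun :: "('a lgfun \<times> 'a lgfun) filter" where
  "uniformity_lgfun = (INF e\<in>{0 <..}. principal {(x, y). dist x y < e})"

definition open_lgfun :: "'a lgfun set \<Rightarrow> bool" where
  "open_lgfun U = (\<forall>x\<in>U. \<forall>\<^sub>F (x', y) in uniformity. x' = x \<longrightarrow> y \<in> U)"

lemma norm_lgfun_upper: "\<bar>apply_lgfun x s / psi1 s\<bar> \<le> norm x"
proof -
  have "bdd_above (range (\<lambda>s. \<bar>apply_lgfun x s / psi1 s\<bar>))"
    using bounded_apply_lgfun[of x] unfolding bounded_iff bdd_above_def by force
  then show ?thesis
    unfolding norm_lgfun_def by (intro cSUP_upper) auto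
qed

lemma norm_lgfun_le: "(\<And>s. \<bar>apply_lgfun x s / psi1 s\<bar> \<le> b) \<Longrightarrow> norm x \<le> b"
  unfolding norm_lgfun_def by (intro cSUP_least) auto

instance
proof
  fix x y :: "'a lgfun" and c :: real
  show "norm x = 0 \<longleftrightarrow> x = 0"
  proof
    assume n: "norm x = 0"
    have "apply_lgfun x s = 0" for s
      using norm_lgfun_upper[of x s] n psi1_pos[of s] by (simp add: divide_le_0_iff)
    then show "x = 0" by (intro lgfun_eqI) simp
  qed (simp add: norm_lgfun_def)
  show "norm (x + y) \<le> norm x + norm y"
  proof (rule norm_lgfun_le)
    fix s
    have "\<bar>apply_lgfun (x + y) s / psi1 s\<bar>
        \<le> \<bar>apply_lgfun x s / psi1 s\<bar> + \<bar>apply_lgfun y s / psi1 s\<bar>"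
      by (simp only: apply_lgfun_simps add_divide_distrib abs_triangle_ineq)
    also have "\<dots> \<le> norm x + norm y"
      by (intro add_mono norm_lgfun_upper)
    finally show "\<bar>apply_lgfun (x + y) s / psi1 s\<bar> \<le> norm x + norm y" .
  qed
  have le: "norm (c *\<^sub>R x) \<le> \<bar>c\<bar> * norm x" for c :: real and x :: "'a lgfun"
  proof (rule norm_lgfun_le)
    fix s
    show "\<bar>apply_lgfun (c *\<^sub>R x) s / psi1 s\<bar> \<le> \<bar>c\<bar> * norm x"
      using mult_left_mono[OF norm_lgfun_upper[of x s], of "\<bar>c\<bar>"]
      by (simp add: abs_mult)
  qed
  show "norm (c *\<^sub>R x) = \<bar>c\<bar> * norm x"
  proof (cases "c = 0")
    case True
    then show ?thesis by (simp add: norm_lgfun_def)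
  next
    case False
    have "norm x = norm (inverse c *\<^sub>R (c *\<^sub>R x))" using False by simp
    also have "\<dots> \<le> \<bar>inverse c\<bar> * norm (c *\<^sub>R x)" by (rule le)
    finally have "\<bar>c\<bar> * norm x \<le> norm (c *\<^sub>R x)"
      using False by (simp add: field_simps abs_mult)
    with le[of c x] show ?thesis by simp
  qed
qed (rule dist_lgfun_def sgn_lgfun_def uniformity_lgfun_def open_lgfun_def)+

end

lemma abs_apply_lgfun_le: "\<bar>apply_lgfun x s\<bar> \<le> norm x * psi1 s"
  using norm_lgfun_upper[of x s] by (simp add: field_simps)


section \<open>Signed measures and their action on the dual space\<close>

definition signed_measure :: "'a measure \<Rightarrow> ('a set \<Rightarrow> real) \<Rightarrow> bool" where
  "signed_measure M m \<longleftrightarrow> m {} = 0 \<and>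
     (\<forall>A :: nat \<Rightarrow> 'a set. range A \<subseteq> sets M \<longrightarrow> disjoint_family A \<longrightarrow>
        (\<lambda>i. m (A i)) sums m (\<Union>i. A i))"

text \<open>The positive and negative parts of the Jordan decomposition. The truncation of
  negative values by \<open>ennreal\<close> is harmless, since the empty set is among the sets \<open>B\<close>.\<close>

definition pos_variation :: "'a measure \<Rightarrow> ('a set \<Rightarrow> real) \<Rightarrow> 'a measure" where
  "pos_variation M m = measure_of (space M) (sets M)
     (\<lambda>A. SUP B\<in>{B \<in> sets M. B \<subseteq> A}. ennreal (m B))"

definition neg_variation :: "'a measure \<Rightarrow> ('a set \<Rightarrow> real) \<Rightarrow> 'a measure" where
  "neg_variation M m = pos_variation M (\<lambda>A. - m A)"

lemma sets_pos_variation [simp]: "sets (pos_variation M m) = sets M"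
  and space_pos_variation [simp]: "space (pos_variation M m) = space M"
  by (simp_all add: pos_variation_def)

lemma signed_measure_Un:
  assumes m: "signed_measure M m" and A: "A \<in> sets M" "B \<in> sets M" "A \<inter> B = {}"
  shows "m (A \<union> B) = m A + m B"
proof -
  have "(\<lambda>i. m (binaryset A B i)) sums m (\<Union>i. binaryset A B i)"
  proof -
    have "disjoint_family (binaryset A B)"
      using A(3) by (simp add: disjoint_family_on_def binaryset_def Int_commute)
    moreover have "range (binaryset A B) \<subseteq> sets M"
      using A(1,2) by (simp add: range_binaryset_eq)
    ultimately show ?thesis
      using m unfolding signed_measure_def by blast
  qed
  moreover have "(\<lambda>i. m (binaryset A B i)) sums (m A + m B)"
    using m by (intro binaryset_sums) (simp add: signed_measure_def)
  ultimately show ?thesis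
    unfolding UN_binaryset_eq by (rule sums_unique2)
qed

lemma emeasure_pos_variation:
  assumes m: "signed_measure M m" and A: "A \<in> sets M"
  shows "emeasure (pos_variation M m) A = (SUP B\<in>{B \<in> sets M. B \<subseteq> A}. ennreal (m B))"
proof -
  define p where "p A = (SUP B\<in>{B \<in> sets M. B \<subseteq> A}. ennreal (m B))" for A
  have m0: "m {} = 0" using m by (simp add: signed_measure_def)
  have upper: "ennreal (m B) \<le> p A" if "B \<in> sets M" "B \<subseteq> A" for A B
    unfolding p_def using that by (intro SUP_upper) auto
  have mono: "p A \<le> p B" if "A \<subseteq> B" for A B
    unfolding p_def using that by (intro SUP_subset_mono) auto
  have p0: "p {} = 0"
    using m0 by (auto simp: p_def intro!: antisym SUP_least)
  have super: "p A + p B \<le> p (A \<union> B)" if "A \<inter> B = {}" for A B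
  proof -
    have ne: "{D \<in> sets M. D \<subseteq> E} \<noteq> {}" for E by auto
    have *: "ennreal (m C) + ennreal (m D) \<le> p (A \<union> B)"
      if "C \<in> sets M" "C \<subseteq> A" "D \<in> sets M" "D \<subseteq> B" for C D
    proof -
      have CD: "m (C \<union> D) = m C + m D"
        using that \<open>A \<inter> B = {}\<close> by (intro signed_measure_Un[OF m]) auto
      have "ennreal (m C) \<le> p (A \<union> B)" "ennreal (m D) \<le> p (A \<union> B)"
           "ennreal (m (C \<union> D)) \<le> p (A \<union> B)"
        using that by (auto intro!: upper)
      then show ?thesis
        by (cases "m C \<ge> 0"; cases "m D \<ge> 0") (auto simp: CD ennreal_neg)
    qed
    have "p A + ennreal (m D) \<le> p (A \<union> B)" if "D \<in> sets M" "D \<subseteq> B" for D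
    proof -
      have "p A + ennreal (m D) = (SUP C\<in>{C \<in> sets M. C \<subseteq> A}. ennreal (m C) + ennreal (m D))"
        unfolding p_def by (subst ennreal_SUP_add_left[OF ne]) auto
      also have "\<dots> \<le> p (A \<union> B)"
        using that by (intro SUP_least *) auto
      finally show ?thesis .
    qed
    moreover have "p A + p B = (SUP D\<in>{D \<in> sets M. D \<subseteq> B}. p A + ennreal (m D))"
      unfolding p_def[of B] by (subst ennreal_SUP_add_right[OF ne]) auto
    ultimately show ?thesis by (auto intro!: SUP_least)
  qed
  have "countably_additive (sets M) p"
  proof (rule countably_additiveI)
    fix A :: "nat \<Rightarrow> 'a set"
    assume A: "range A \<subseteq> sets M" "disjoint_family A" "\<Union>(range A) \<in> sets M"
    have fin: "(\<Sum>i<n. p (A i)) \<le> p (\<Union>i<n. A i)" for n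
    proof (induction n)
      case (Suc n)
      have "(\<Sum>i<Suc n. p (A i)) \<le> p (\<Union>i<n. A i) + p (A n)"
        using Suc by (simp add: add_right_mono)
      also have "\<dots> \<le> p ((\<Union>i<n. A i) \<union> A n)"
      proof (rule super)
        have "A i \<inter> A n = {}" if "i < n" for i
          using disjoint_family_onD[OF A(2), of i n] that by simp
        then show "(\<Union>i<n. A i) \<inter> A n = {}" by blast
      qed
      finally show ?case by (simp add: lessThan_Suc Un_commute)
    qed (simp add: p0)
    show "(\<Sum>i. p (A i)) = p (\<Union>(range A))"
    proof (rule antisym)
      show "(\<Sum>i. p (A i)) \<le> p (\<Union>(range A))"
      proof (rule suminf_le_const[OF summableI])
        fix n
        have "p (\<Union>i<n. A i) \<le> p (\<Union>(range A))" by (intro mono) auto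
        with fin[of n] show "(\<Sum>i<n. p (A i)) \<le> p (\<Union>(range A))" by (rule order_trans)
      qed
      show "p (\<Union>(range A)) \<le> (\<Sum>i. p (A i))"
        unfolding p_def[of "\<Union>(range A)"]
      proof (rule SUP_least, clarify)
        fix B assume B: "B \<in> sets M" "B \<subseteq> \<Union>(range A)"
        have "disjoint_family (\<lambda>i. B \<inter> A i)"
          using A(2) by (rule disjoint_family_on_bisimulation) blast
        moreover have "range (\<lambda>i. B \<inter> A i) \<subseteq> sets M" using A B by auto
        ultimately have "(\<lambda>i. m (B \<inter> A i)) sums m (\<Union>i. B \<inter> A i)"
          using m unfolding signed_measure_def by blast
        moreover have "(\<Union>i. B \<inter> A i) = B" using B by auto
        ultimately have s: "(\<lambda>n. \<Sum>i<n. m (B \<inter> A i)) \<longlonglongrightarrow> m B"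
          by (simp add: sums_def)
        have le: "ennreal (\<Sum>i<n. m (B \<inter> A i)) \<le> (\<Sum>i. p (A i))" for n
        proof -
          have "ennreal (\<Sum>i<n. m (B \<inter> A i)) \<le> ennreal (\<Sum>i<n. max 0 (m (B \<inter> A i)))"
            by (intro ennreal_leI sum_mono) auto
          also have "\<dots> = (\<Sum>i<n. ennreal (max 0 (m (B \<inter> A i))))"
            by (rule sum_ennreal[symmetric]) auto
          also have "\<dots> \<le> (\<Sum>i<n. p (A i))"
          proof (rule sum_mono)
            fix i
            have "ennreal (m (B \<inter> A i)) \<le> p (A i)"
              using A B by (intro upper) auto
            then show "ennreal (max 0 (m (B \<inter> A i))) \<le> p (A i)"
              by (cases "m (B \<inter> A i) \<ge> 0") (auto simp: max_def)
          qed
          also have "\<dots> \<le> (\<Sum>i. p (A i))"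
            by (rule sum_le_suminf) auto
          finally show ?thesis .
        qed
        show "ennreal (m B) \<le> (\<Sum>i. p (A i))"
          by (rule LIMSEQ_le_const2[OF tendsto_ennrealI[OF s]]) (use le in auto)
      qed
    qed
  qed
  moreover have "positive (sets M) p" by (simp add: positive_def p0)
  ultimately have "emeasure (measure_of (space M) (sets M) p) A = p A"
    using A by (intro emeasure_measure_of_sigma sets.sigma_algebra_axioms)
  then show ?thesis
    unfolding pos_variation_def p_def .
qed

definition signed_integrable :: "'a measure \<Rightarrow> ('a set \<Rightarrow> real) \<Rightarrow> ('a \<Rightarrow> real) \<Rightarrow> bool" where
  "signed_integrable M m f \<longleftrightarrow>
     integrable (pos_variation M m) f \<and> integrable (neg_variation M m) f"

definition signed_integral :: "'a measure \<Rightarrow> ('a set \<Rightarrow> real) \<Rightarrow> ('a \<Rightarrow> real) \<Rightarrow> real" where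
  "signed_integral M m f = (LINT s|pos_variation M m. f s) - (LINT s|neg_variation M m. f s)"

text \<open>The space \<open>M\<^sub>t\<close>, seen as a subset of the dual of \<open>C\<^sub>t\<close> through integration.\<close>

definition measure_functionals :: "('a::euclidean_space lgfun \<Rightarrow>\<^sub>L real) set" where
  "measure_functionals =
     {\<phi>. \<exists>m. signed_measure borel m \<and> signed_integrable borel m psi1 \<and>
            (\<forall>x. blinfun_apply \<phi> x = signed_integral borel m (apply_lgfun x))}"

text \<open>The functional given by a nonnegative element of \<open>M\<^sub>t\<close>. The following lemma
  shows that \<open>Blinfun\<close> is applied to a bounded linear map.\<close>

definition integral_functional :: "'a::euclidean_space measure \<Rightarrow> 'a lgfun \<Rightarrow>\<^sub>L real" where
  "integral_functional \<mu> = Blinfun (\<lambda>x. LINT s|\<mu>. apply_lgfun x s)"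

lemma integrable_lgfun:
  assumes "sets \<mu> = sets borel" "integrable \<mu> psi1"
  shows "integrable \<mu> (apply_lgfun x)"
proof (rule Bochner_Integration.integrable_bound)
  show "integrable \<mu> (\<lambda>s. norm x * psi1 s)" using assms(2) by simp
  have "apply_lgfun x \<in> borel_measurable borel"
    by (rule borel_measurable_continuous_onI[OF continuous_apply_lgfun])
  then show "apply_lgfun x \<in> borel_measurable \<mu>"
    using measurable_cong_sets[OF assms(1) refl] by blast
  show "AE s in \<mu>. norm (apply_lgfun x s) \<le> norm (norm x * psi1 s)"
    using abs_apply_lgfun_le by (auto simp: abs_mult)
qed

lemma integral_functional_apply:
  assumes "sets \<mu> = sets borel" "integrable \<mu> psi1"
  shows "blinfun_apply (integral_functional \<mu>) x = (LINT s|\<mu>. apply_lgfun x s)"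
proof -
  have "bounded_linear (\<lambda>x. LINT s|\<mu>. apply_lgfun x s)"
  proof (rule bounded_linear_intro[where K = "LINT s|\<mu>. psi1 s"])
    fix x :: "'a lgfun"
    have "norm (LINT s|\<mu>. apply_lgfun x s) \<le> (LINT s|\<mu>. norm x * psi1 s)"
      using assms abs_apply_lgfun_le
      by (intro Bochner_Integration.integral_norm_bound_integral integrable_lgfun) auto
    then show "norm (LINT s|\<mu>. apply_lgfun x s) \<le> norm x * (LINT s|\<mu>. psi1 s)" by simp
  qed (simp_all add: integrable_lgfun[OF assms])
  then show ?thesis
    by (simp add: integral_functional_def bounded_linear_Blinfun_apply)
qed


section \<open>Extended real-valued functions\<close>

definition proper_convex :: "('a::real_vector \<Rightarrow> ereal) \<Rightarrow> bool" where
  "proper_convex G \<longleftrightarrow> (\<forall>x. G x \<noteq> -\<infinity>) \<and> (\<exists>x. G x \<noteq> \<infinity>) \<and>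
     (\<forall>x y a. 0 < a \<and> a < 1 \<longrightarrow>
        G (a *\<^sub>R x + (1 - a) *\<^sub>R y) \<le> ereal a * G x + ereal (1 - a) * G y)"

definition edom :: "('a \<Rightarrow> ereal) \<Rightarrow> 'a set" where
  "edom G = {x. G x < \<infinity>}"

definition conjugate :: "('a::real_normed_vector \<Rightarrow> ereal) \<Rightarrow> ('a \<Rightarrow>\<^sub>L real) \<Rightarrow> ereal" where
  "conjugate G \<phi> = (SUP x. ereal (blinfun_apply \<phi> x) - G x)"

text \<open>The integral with value in \<open>[-\<infinity>, \<infinity>]\<close> of a real-valued function,
  meaningful when the positive or the negative part is integrable.\<close>

definition ext_integral :: "'a measure \<Rightarrow> ('a \<Rightarrow> real) \<Rightarrow> ereal" where
  "ext_integral M f =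
     enn2ereal (\<integral>\<^sup>+ s. ennreal (f s) \<partial>M) - enn2ereal (\<integral>\<^sup>+ s. ennreal (- f s) \<partial>M)"


section \<open>Path space\<close>

text \<open>A path \<open>(s\<^sub>0, \<dots>, s\<^sub>t)\<close> is an extensional function on \<open>{..t}\<close>; its initial
  segment up to time \<open>r\<close> is \<open>restrict s {..r}\<close>.\<close>

definition path_top :: "nat \<Rightarrow> (nat \<Rightarrow> 'a::euclidean_space) topology" where
  "path_top t = product_topology (\<lambda>_. euclidean) {..t}"

definition paths :: "nat \<Rightarrow> (nat \<Rightarrow> 'a::euclidean_space) set" where
  "paths t = PiE {..t} (\<lambda>_. UNIV)"

text \<open>By second countability, the product \<open>\<sigma>\<close>-algebra is the Borel \<open>\<sigma>\<close>-algebra of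
  \<open>path_top t\<close>.\<close>

definition path_borel :: "nat \<Rightarrow> (nat \<Rightarrow> 'a::euclidean_space) measure" where
  "path_borel t = PiM {..t} (\<lambda>_. borel)"

definition psi :: "nat \<Rightarrow> (nat \<Rightarrow> 'a::euclidean_space) \<Rightarrow> real" where
  "psi T s = (\<Sum>t\<le>T. psi1 (s t))"

definition usc_on_paths :: "nat \<Rightarrow> ((nat \<Rightarrow> 'a::euclidean_space) \<Rightarrow> real) \<Rightarrow> bool" where
  "usc_on_paths T u \<longleftrightarrow> (\<forall>a. openin (path_top T) {s \<in> paths T. u s < a})"

definition trading_strategies ::
    "nat \<Rightarrow> (nat \<Rightarrow> (nat \<Rightarrow> 'a::euclidean_space) \<Rightarrow> 'a) set" where
  "trading_strategies T =
     {z. \<forall>t<T. z t \<in> borel_measurable (path_borel t) \<and> bounded (z t ` paths t)}"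

definition gain :: "nat \<Rightarrow> (nat \<Rightarrow> (nat \<Rightarrow> 'a::euclidean_space) \<Rightarrow> 'a) \<Rightarrow> (nat \<Rightarrow> 'a) \<Rightarrow> real" where
  "gain T z s = (\<Sum>t<T. z t (restrict s {..t}) \<bullet> (s (Suc t) - s t))"

definition nonneg_measures :: "nat \<Rightarrow> (nat \<Rightarrow> 'a::euclidean_space) measure set" where
  "nonneg_measures T =
     {\<mu>. sets \<mu> = sets (path_borel T) \<and> finite_measure \<mu> \<and> integrable \<mu> (psi T)}"

definition martingale_measures :: "nat \<Rightarrow> (nat \<Rightarrow> 'a::euclidean_space) measure set" where
  "martingale_measures T =
     {\<mu> \<in> nonneg_measures T. \<forall>z \<in> trading_strategies T. (LINT s|\<mu>. gain T z s) = 0}"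

definition marginal :: "(nat \<Rightarrow> 'a::euclidean_space) measure \<Rightarrow> nat \<Rightarrow> 'a measure" where
  "marginal \<mu> t = distr \<mu> borel (\<lambda>s. s t)"


section \<open>The two optimization problems\<close>

definition constraint_A ::
    "nat \<Rightarrow> ((nat \<Rightarrow> 'a::euclidean_space) \<Rightarrow> real) \<Rightarrow> (nat \<Rightarrow> 'a lgfun) \<Rightarrow>
     (nat \<Rightarrow> (nat \<Rightarrow> 'a) \<Rightarrow> 'a) \<Rightarrow> bool" where
  "constraint_A T u x z \<longleftrightarrow>
     (\<forall>s \<in> paths T. u s \<le> gain T z s + (\<Sum>t\<le>T. apply_lgfun (x t) (s t)))"

definition feasible_A ::
    "nat \<Rightarrow> (nat \<Rightarrow> 'a::euclidean_space lgfun \<Rightarrow> ereal) \<Rightarrow> ((nat \<Rightarrow> 'a) \<Rightarrow> real) \<Rightarrow> bool" where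
  "feasible_A T G u \<longleftrightarrow>
     (\<exists>x. \<exists>z \<in> trading_strategies T. (\<forall>t\<le>T. x t \<in> edom (G t)) \<and> constraint_A T u x z)"

definition value_A ::
    "nat \<Rightarrow> (nat \<Rightarrow> 'a::euclidean_space lgfun \<Rightarrow> ereal) \<Rightarrow> ((nat \<Rightarrow> 'a) \<Rightarrow> real) \<Rightarrow> ereal" where
  "value_A T G u =
     Inf {\<Sum>t\<le>T. G t (x t) | x z. z \<in> trading_strategies T \<and> constraint_A T u x z}"

definition objective_B ::
    "nat \<Rightarrow> (nat \<Rightarrow> 'a::euclidean_space lgfun \<Rightarrow> ereal) \<Rightarrow> ((nat \<Rightarrow> 'a) \<Rightarrow> real) \<Rightarrow>
     (nat \<Rightarrow> 'a) measure \<Rightarrow> ereal" where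
  "objective_B T G u \<mu> =
     (\<Sum>t\<le>T. conjugate (G t) (integral_functional (marginal \<mu> t))) - ext_integral \<mu> u"

definition value_B ::
    "nat \<Rightarrow> (nat \<Rightarrow> 'a::euclidean_space lgfun \<Rightarrow> ereal) \<Rightarrow> ((nat \<Rightarrow> 'a) \<Rightarrow> real) \<Rightarrow> ereal" where
  "value_B T G u = (INF \<mu> \<in> martingale_measures T. objective_B T G u \<mu>)"

end

theory Submission
  imports Defs
begin

text \<open>Weak duality, \<open>- value_A \<le> objective_B\<close> on the martingale measures, follows by integrating the
  constraint of (A) and applying the Fenchel inequality at each time (\<open>weak_duality\<close>). The converse
  and the attainment come from a subgradient of the value function of (A).

  Perturb \<open>u\<close> to \<open>u + w \<psi>\<close> with a bounded continuous function \<open>w\<close>. The value of (A) is a convex,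
  nondecreasing function of \<open>w\<close>, and it is bounded above for \<open>w \<le> \<epsilon>\<close> because (A) remains feasible for
  \<open>u + \<epsilon> \<psi>\<close>. If it is finite at \<open>w = 0\<close>, then it has a subgradient \<open>L\<close> there
  (\<open>algebraic_subgradient\<close>, from the Hahn-Banach theorem), and \<open>L\<close> is positive. Scaling the strategies
  shows that \<open>L\<close> vanishes on the gains of bounded continuous strategies. Taking the supremum over \<open>x\<close>
  in the subgradient inequality bounds \<open>\<Sum>\<^sub>t G\<^sub>t\<^sup>*(\<phi>\<^sub>t) + L v\<close> by \<open>- value_A\<close>, for every continuous
  \<open>v \<le> - u / \<psi>\<close>, where \<open>\<phi>\<^sub>t\<close> is the \<open>t\<close>-th marginal of \<open>L\<close>. Since \<open>u \<le> K \<psi>\<close>, the constant \<open>v = - K\<close>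
  is one of these, so \<open>\<phi>\<^sub>t\<close> lies in the domain of \<open>G\<^sub>t\<^sup>*\<close> and by assumption is a measure.

  Measures are tight, hence \<open>L\<close> itself is continuous along sequences that decrease to \<open>0\<close>
  (\<open>daniell_functionalI_tight\<close>) and so is the integral with respect to a finite measure
  (\<open>daniell_functional.J_eq_integral\<close>, a Riesz representation theorem without compactness). Dividing
  this measure by \<open>\<psi>\<close> gives the solution \<open>\<mu>\<close> of (B): it is a martingale measure because bounded
  continuous strategies determine the martingale property (\<open>martingale_measuresI\<close>), and letting \<open>v\<close>
  increase to the lower semicontinuous function \<open>- u / \<psi>\<close> turns the bound above into
  \<open>objective_B \<mu> \<le> - value_A\<close> (\<open>dual_solution_exists\<close>). If the value of (A) is \<open>- \<infinity>\<close>, weak duality alone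
  shows that every martingale measure, for instance the zero measure, is optimal.

  Functionals and measures on paths are first constructed on the space of all sequences, which is a
  metric space as a type, and then transported to \<open>paths T\<close> by restriction to \<open>{..T}\<close>.\<close>

section \<open>Sublinear functionals and subgradients\<close>

text \<open>Subadditive and positively homogeneous functionals. Homogeneity is demanded for positive
  factors only; \<open>p 0 = 0\<close> follows from it.\<close>

definition sublinear :: "('v::real_vector \<Rightarrow> real) \<Rightarrow> bool" where
  "sublinear p \<longleftrightarrow> (\<forall>x y. p (x + y) \<le> p x + p y) \<and> (\<forall>c>0. \<forall>x. p (c *\<^sub>R x) = c * p x)"

lemma sublinearI:
  assumes "\<And>x y. p (x + y) \<le> p x + p y" and "\<And>c x. c > 0 \<Longrightarrow> p (c *\<^sub>R x) \<le> c * p x"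
  shows "sublinear p"
  unfolding sublinear_def
proof (intro conjI allI impI antisym)
  fix c :: real and x assume c: "c > 0"
  have "p (inverse c *\<^sub>R (c *\<^sub>R x)) \<le> inverse c * p (c *\<^sub>R x)"
    using c by (intro assms(2)) simp
  then show "c * p x \<le> p (c *\<^sub>R x)" using c by (simp add: field_simps)
qed (use assms in auto)

lemma sublinear_add: "sublinear p \<Longrightarrow> p (x + y) \<le> p x + p y"
  and sublinear_scale: "sublinear p \<Longrightarrow> c > 0 \<Longrightarrow> p (c *\<^sub>R x) = c * p x"
  by (simp_all add: sublinear_def)

lemma sublinear_0 [simp]: "sublinear p \<Longrightarrow> p 0 = 0"
  using sublinear_scale[of p 2 0] by simp

lemma sublinear_minus: "sublinear p \<Longrightarrow> - p (- x) \<le> p x"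
  using sublinear_add[of p x "- x"] by simp

text \<open>The pointwise order on sublinear functionals replaces the usual extension of functionals
  from subspaces: a minimal sublinear functional is already linear.\<close>

lemma minimal_sublinear_linear:
  assumes p: "sublinear p" and min: "\<And>q. sublinear q \<Longrightarrow> (\<And>x. q x \<le> p x) \<Longrightarrow> q = p"
  shows "linear p"
proof -
  have add: "p (x + y) = p x + p y" for x y
  proof (rule antisym[OF sublinear_add[OF p]])
    \<comment> \<open>\<open>q\<close> is sublinear and lies below \<open>p\<close>, and it satisfies \<open>q x \<le> p (x + y) - p y\<close>; by
      minimality it equals \<open>p\<close>, which is superadditivity in the direction \<open>y\<close>.\<close>
    define S where "S x = (\<lambda>t. p (x + t *\<^sub>R y) - t * p y) ` {0..}" for x
    define q where "q x = Inf (S x)" for x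
    have tp: "t * p y = p (t *\<^sub>R y)" if "t \<ge> 0" for t
      using that sublinear_scale[OF p, of t y] p by (cases "t = 0") auto
    have low: "- p (- x) \<le> p (x + t *\<^sub>R y) - t * p y" if "t \<ge> 0" for t x
      using sublinear_add[OF p, of "x + t *\<^sub>R y" "- x"] that by (simp add: tp)
    have bdd: "bdd_below (S x)" for x
      unfolding S_def using low by (intro bdd_belowI2) auto
    have qle: "q x \<le> p (x + t *\<^sub>R y) - t * p y" if "t \<ge> 0" for t x
      unfolding q_def using bdd that by (intro cInf_lower) (auto simp: S_def)
    have qge: "c \<le> q x" if "\<And>t. t \<ge> 0 \<Longrightarrow> c \<le> p (x + t *\<^sub>R y) - t * p y" for c x
      unfolding q_def using that by (intro cInf_greatest) (auto simp: S_def)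
    have "sublinear q"
    proof (rule sublinearI)
      fix x x'
      have *: "q (x + x') \<le> (p (x + t *\<^sub>R y) - t * p y) + (p (x' + t' *\<^sub>R y) - t' * p y)"
        if "t \<ge> 0" "t' \<ge> 0" for t t'
      proof -
        have "q (x + x') \<le> p ((x + x') + (t + t') *\<^sub>R y) - (t + t') * p y"
          using that by (intro qle) simp
        also have "(x + x') + (t + t') *\<^sub>R y = (x + t *\<^sub>R y) + (x' + t' *\<^sub>R y)"
          by (simp add: algebra_simps)
        finally show ?thesis
          using sublinear_add[OF p, of "x + t *\<^sub>R y" "x' + t' *\<^sub>R y"] by (simp add: algebra_simps)
      qed
      have "q (x + x') - (p (x + t *\<^sub>R y) - t * p y) \<le> q x'" if "t \<ge> 0" for t
        using *[OF that] by (intro qge) (simp add: algebra_simps)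
      then have "q (x + x') - q x' \<le> q x"
        by (intro qge) (simp add: algebra_simps)
      then show "q (x + x') \<le> q x + q x'" by simp
    next
      fix c :: real and x assume c: "c > 0"
      have "q (c *\<^sub>R x) / c \<le> q x"
      proof (rule qge)
        fix t :: real assume "t \<ge> 0"
        then have "q (c *\<^sub>R x) \<le> p (c *\<^sub>R x + (c * t) *\<^sub>R y) - (c * t) * p y"
          using c by (intro qle) simp
        also have "c *\<^sub>R x + (c * t) *\<^sub>R y = c *\<^sub>R (x + t *\<^sub>R y)" by (simp add: algebra_simps)
        also have "p \<dots> = c * p (x + t *\<^sub>R y)" using sublinear_scale[OF p c] .
        finally show "q (c *\<^sub>R x) / c \<le> p (x + t *\<^sub>R y) - t * p y"
          using c by (simp add: field_simps)
      qed
      then show "q (c *\<^sub>R x) \<le> c * q x" using c by (simp add: field_simps)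
    qed
    moreover have "q x \<le> p x" for x using qle[of 0 x] by simp
    ultimately have "q = p" by (rule min)
    then show "p x + p y \<le> p (x + y)" using qle[of 1 x] by simp
  qed
  have neg: "p (- x) = - p x" for x using add[of x "- x"] p by simp
  show ?thesis
  proof (rule linearI)
    fix c :: real and x
    show "p (c *\<^sub>R x) = c *\<^sub>R p x"
    proof (cases c "0::real" rule: linorder_cases)
      case less
      then have "p (c *\<^sub>R x) = - p ((- c) *\<^sub>R x)" using neg[of "c *\<^sub>R x"] by simp
      also have "\<dots> = c * p x" using less by (subst sublinear_scale[OF p]) auto
      finally show ?thesis by simp
    qed (use p sublinear_scale[OF p] in auto)
  qed (rule add)
qed

theorem hahn_banach_sublinear:
  assumes p: "sublinear p"
  shows "\<exists>l. linear l \<and> (\<forall>x. l x \<le> p x)"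
proof -
  define A where "A = {q. sublinear q \<and> (\<forall>x. q x \<le> p x)}"
  define R where "R = (\<lambda>a b :: 'a \<Rightarrow> real. \<forall>x. b x \<le> a x)"
  have "\<exists>m\<in>A. \<forall>a\<in>A. R m a \<longrightarrow> a = m"
  proof (rule predicate_Zorn)
    show "partial_order_on A (relation_of R A)"
      by (rule partial_order_on_relation_ofI) (auto simp: R_def fun_eq_iff intro: order_trans antisym)
    fix C assume C: "C \<in> Chains (relation_of R A)"
    then have CA: "C \<subseteq> A" and ch: "\<And>a b. a \<in> C \<Longrightarrow> b \<in> C \<Longrightarrow> R a b \<or> R b a"
      by (auto simp: Chains_def relation_of_def)
    show "\<exists>u\<in>A. \<forall>a\<in>C. R a u"
    proof (cases "C = {}")
      case True
      then show ?thesis using p by (auto simp: A_def)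
    next
      case False
      \<comment> \<open>The pointwise infimum of a chain is again sublinear, since any two members of the chain
          can be replaced by the smaller one.\<close>
      define u where "u x = (INF q\<in>C. q x)" for x
      have low: "- p (- x) \<le> q x" if "q \<in> C" for q x
      proof -
        have "sublinear q" "q (- x) \<le> p (- x)" using that CA by (auto simp: A_def)
        then show ?thesis using sublinear_minus[of q x] by simp
      qed
      have ule: "u x \<le> q x" if "q \<in> C" for q x
        unfolding u_def using that low by (intro cINF_lower bdd_belowI2)
      have uge: "c \<le> u x" if "\<And>q. q \<in> C \<Longrightarrow> c \<le> q x" for c x
        unfolding u_def using False that by (intro cINF_greatest)
      have "sublinear u"
      proof (rule sublinearI)
        fix x y
        have *: "u (x + y) \<le> q x + r y" if qr: "q \<in> C" "r \<in> C" for q r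
        proof -
          have "\<exists>s\<in>C. s x \<le> q x \<and> s y \<le> r y"
            using ch[OF qr] qr unfolding R_def by blast
          then obtain s where s: "s \<in> C" "s x \<le> q x" "s y \<le> r y" by blast
          then have "u (x + y) \<le> s x + s y"
            using ule[OF s(1), of "x + y"] sublinear_add[of s x y] CA by (auto simp: A_def)
          then show ?thesis using s by simp
        qed
        have "u (x + y) - q x \<le> u y" if "q \<in> C" for q
          using *[OF that] by (intro uge) (simp add: algebra_simps)
        then have "u (x + y) - u y \<le> u x"
          by (intro uge) (simp add: algebra_simps)
        then show "u (x + y) \<le> u x + u y" by simp
      next
        fix c :: real and x assume c: "c > 0"
        have "u (c *\<^sub>R x) / c \<le> u x"
        proof (rule uge)
          fix q assume q: "q \<in> C"
          then have "q (c *\<^sub>R x) = c * q x" using CA c by (auto simp: A_def sublinear_scale)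
          then show "u (c *\<^sub>R x) / c \<le> q x"
            using ule[OF q, of "c *\<^sub>R x"] c by (simp add: field_simps)
        qed
        then show "u (c *\<^sub>R x) \<le> c * u x" using c by (simp add: field_simps)
      qed
      moreover have "u x \<le> p x" for x
      proof -
        obtain q where "q \<in> C" using False by blast
        then show ?thesis using ule[of q x] CA by (auto simp: A_def intro: order_trans)
      qed
      ultimately have "u \<in> A" by (simp add: A_def)
      then show ?thesis using ule by (auto simp: R_def)
    qed
  qed
  then obtain m where m: "m \<in> A" "\<And>a. a \<in> A \<Longrightarrow> R m a \<Longrightarrow> a = m" by blast
  have "linear m"
  proof (rule minimal_sublinear_linear)
    fix q assume "sublinear q" "\<And>x. q x \<le> m x"
    then show "q = m" using m(1) by (intro m(2)) (auto simp: A_def R_def intro: order_trans)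
  qed (use m in \<open>simp add: A_def\<close>)
  then show ?thesis using m(1) by (auto simp: A_def)
qed

text \<open>A convex function that is finite at \<open>0\<close> and bounded above near \<open>0\<close> along every line has a
  subgradient at \<open>0\<close>. The function is given by a convex subset \<open>P\<close> of its epigraph, which avoids
  values \<open>\<plusminus>\<infinity>\<close>, and no topology is involved. The proof applies the Hahn-Banach theorem to the
  directional derivative \<open>p w = inf {(g - \<alpha>) / \<tau>}\<close> over \<open>\<tau> > 0\<close> and \<open>(\<tau> w, g) \<in> P\<close>.\<close>

theorem algebraic_subgradient:
  fixes P :: "('v::real_vector \<times> real) set"
  assumes "convex P"
    and absorb: "\<And>w. \<exists>\<tau>>0. \<exists>g. (\<tau> *\<^sub>R w, g) \<in> P"
    and low: "\<And>g. (0, g) \<in> P \<Longrightarrow> \<alpha> \<le> g"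
  shows "\<exists>l. linear l \<and> (\<forall>w g. (w, g) \<in> P \<longrightarrow> \<alpha> + l w \<le> g)"
proof -
  define S where "S w = {(g - \<alpha>) / \<tau> | g \<tau>. \<tau> > 0 \<and> (\<tau> *\<^sub>R w, g) \<in> P}" for w
  define p where "p w = Inf (S w)" for w
  \<comment> \<open>The weights \<open>\<sigma> / (\<tau> + \<sigma>)\<close> and \<open>\<tau> / (\<tau> + \<sigma>)\<close> turn \<open>\<tau> v\<close> and \<open>\<sigma> w\<close> into a common
    multiple of \<open>v + w\<close>, so that the difference quotients add up.\<close>
  have comb: "\<exists>k. (((\<tau> * \<sigma>) / (\<tau> + \<sigma>)) *\<^sub>R (v + w), k) \<in> P \<and>
       (k - \<alpha>) / ((\<tau> * \<sigma>) / (\<tau> + \<sigma>)) = (g - \<alpha>) / \<tau> + (h - \<alpha>) / \<sigma>"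
    if "\<tau> > 0" "\<sigma> > 0" "(\<tau> *\<^sub>R v, g) \<in> P" "(\<sigma> *\<^sub>R w, h) \<in> P" for \<tau> \<sigma> v w g h
  proof -
    have "(\<sigma> / (\<tau> + \<sigma>)) *\<^sub>R (\<tau> *\<^sub>R v, g) + (\<tau> / (\<tau> + \<sigma>)) *\<^sub>R (\<sigma> *\<^sub>R w, h) \<in> P"
      using that by (intro convexD[OF \<open>convex P\<close>]) (auto simp flip: add_divide_distrib)
    then have "(((\<tau> * \<sigma>) / (\<tau> + \<sigma>)) *\<^sub>R (v + w), (\<sigma> * g + \<tau> * h) / (\<tau> + \<sigma>)) \<in> P"
      by (simp add: algebra_simps add_divide_distrib)
    moreover have "((\<sigma> * g + \<tau> * h) / (\<tau> + \<sigma>) - \<alpha>) / ((\<tau> * \<sigma>) / (\<tau> + \<sigma>)) = (g - \<alpha>) / \<tau> + (h - \<alpha>) / \<sigma>"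
    proof -
      have *: "\<tau> + \<sigma> > 0" using that by simp
      then have "(\<sigma> * g + \<tau> * h) / (\<tau> + \<sigma>) - \<alpha> = (\<sigma> * (g - \<alpha>) + \<tau> * (h - \<alpha>)) / (\<tau> + \<sigma>)"
        by (simp add: field_simps)
      then have "((\<sigma> * g + \<tau> * h) / (\<tau> + \<sigma>) - \<alpha>) / ((\<tau> * \<sigma>) / (\<tau> + \<sigma>)) =
          (\<sigma> * (g - \<alpha>) + \<tau> * (h - \<alpha>)) / (\<tau> * \<sigma>)"
        using * by simp
      then show ?thesis using that by (simp add: add_divide_distrib)
    qed
    ultimately show ?thesis by blast
  qed
  have ne: "S w \<noteq> {}" for w using absorb[of w] by (auto simp: S_def)
  have bdd: "bdd_below (S w)" for w
  proof -
    obtain \<sigma> h where s: "\<sigma> > 0" "(\<sigma> *\<^sub>R (- w), h) \<in> P" using absorb[of "- w"] by blast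
    show ?thesis
    proof (rule bdd_belowI[where m = "- (h - \<alpha>) / \<sigma>"])
      fix r assume "r \<in> S w"
      then obtain g \<tau> where r: "r = (g - \<alpha>) / \<tau>" "\<tau> > 0" "(\<tau> *\<^sub>R w, g) \<in> P" by (auto simp: S_def)
      obtain k where "(((\<tau> * \<sigma>) / (\<tau> + \<sigma>)) *\<^sub>R (w + - w), k) \<in> P"
        and k: "(k - \<alpha>) / ((\<tau> * \<sigma>) / (\<tau> + \<sigma>)) = (g - \<alpha>) / \<tau> + (h - \<alpha>) / \<sigma>"
        using comb[OF r(2) s(1) r(3) s(2)] by blast
      then have "k \<ge> \<alpha>" using low by simp
      then have "0 \<le> (k - \<alpha>) / ((\<tau> * \<sigma>) / (\<tau> + \<sigma>))" using r s by simp
      then show "- (h - \<alpha>) / \<sigma> \<le> r" unfolding k r(1) by (simp add: diff_divide_distrib)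
    qed
  qed
  have ple: "p w \<le> (g - \<alpha>) / \<tau>" if "\<tau> > 0" "(\<tau> *\<^sub>R w, g) \<in> P" for w g \<tau>
    unfolding p_def using that bdd by (intro cInf_lower) (auto simp: S_def)
  have pge: "c \<le> p w" if "\<And>g \<tau>. \<tau> > 0 \<Longrightarrow> (\<tau> *\<^sub>R w, g) \<in> P \<Longrightarrow> c \<le> (g - \<alpha>) / \<tau>" for w c
    unfolding p_def using that ne by (intro cInf_greatest) (auto simp: S_def)
  have "sublinear p"
  proof (rule sublinearI)
    fix v w
    have *: "p (v + w) \<le> (g - \<alpha>) / \<tau> + (h - \<alpha>) / \<sigma>"
      if t: "\<tau> > 0" "(\<tau> *\<^sub>R v, g) \<in> P" "\<sigma> > 0" "(\<sigma> *\<^sub>R w, h) \<in> P" for \<tau> \<sigma> g h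
    proof -
      obtain k where k: "(((\<tau> * \<sigma>) / (\<tau> + \<sigma>)) *\<^sub>R (v + w), k) \<in> P"
        "(k - \<alpha>) / ((\<tau> * \<sigma>) / (\<tau> + \<sigma>)) = (g - \<alpha>) / \<tau> + (h - \<alpha>) / \<sigma>"
        using comb[OF t(1,3,2,4)] by blast
      show ?thesis unfolding k(2)[symmetric] using t k(1) by (intro ple) auto
    qed
    have "p (v + w) - (g - \<alpha>) / \<tau> \<le> p w" if "\<tau> > 0" "(\<tau> *\<^sub>R v, g) \<in> P" for \<tau> g
      using *[OF that] by (intro pge) (smt (verit))
    then have "p (v + w) - p w \<le> p v"
      by (intro pge) (smt (verit))
    then show "p (v + w) \<le> p v + p w" by simp
  next
    fix c :: real and w assume c: "c > 0"
    have "p (c *\<^sub>R w) / c \<le> p w"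
    proof (rule pge)
      fix g \<tau> assume "\<tau> > 0" "(\<tau> *\<^sub>R w, g) \<in> P"
      then have "p (c *\<^sub>R w) \<le> (g - \<alpha>) / (\<tau> / c)" using c by (intro ple) auto
      then show "p (c *\<^sub>R w) / c \<le> (g - \<alpha>) / \<tau>" using c by (simp add: field_simps)
    qed
    then show "p (c *\<^sub>R w) \<le> c * p w" using c by (simp add: field_simps)
  qed
  then obtain l where l: "linear l" "\<And>x. l x \<le> p x" using hahn_banach_sublinear by blast
  have "\<alpha> + l w \<le> g" if "(w, g) \<in> P" for w g
    using ple[of 1 w g] l(2)[of w] that by simp
  then show ?thesis using l(1) by blast
qed

section \<open>Riesz representation of Daniell integrals\<close>

lemma apply_Bcontfun:
  fixes f :: "'b::topological_space \<Rightarrow> real"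
  assumes "continuous_on UNIV f" "\<And>x. \<bar>f x\<bar> \<le> b"
  shows "apply_bcontfun (Bcontfun f) = f"
  using bcontfun_normI[of f b] assms by (intro Bcontfun_inverse) auto

lemma continuous_on_apply_bcontfun_comp [continuous_intros]:
  "continuous_on A g \<Longrightarrow> continuous_on A (\<lambda>x. apply_bcontfun f (g x))"
  by (rule continuous_on_compose2[OF continuous_on_apply_bcontfun[of UNIV f]]) auto

lemma measurable_apply_bcontfun [measurable]:
  "apply_bcontfun f \<in> borel_measurable borel"
  by (rule borel_measurable_continuous_onI) simp

lemma sum_apply_bcontfun:
  fixes f :: "'i \<Rightarrow> 'b::topological_space \<Rightarrow>\<^sub>C real"
  shows "apply_bcontfun (\<Sum>i\<in>I. f i) x = (\<Sum>i\<in>I. apply_bcontfun (f i) x)"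
  by (induction I rule: infinite_finite_induct) auto

text \<open>The case \<open>U = UNIV\<close> is separate because the distance to the empty set is \<open>0\<close> by convention.\<close>

lemma open_indicator_approx:
  fixes U :: "'b::metric_space set"
  assumes "open U"
  obtains b :: "nat \<Rightarrow> 'b \<Rightarrow>\<^sub>C real" where
    "\<And>n x. 0 \<le> b n x" "\<And>n x. b n x \<le> indicator U x" "\<And>n x. b n x \<le> b (Suc n) x"
    "\<And>x. (\<lambda>n. b n x) \<longlonglongrightarrow> indicator U x"
proof (cases "U = UNIV")
  case True
  show ?thesis by (rule that[of "\<lambda>_. const_bcontfun 1"]) (auto simp: True)
next
  case False
  define f where "f n x = min 1 (real n * infdist x (- U))" for n x
  have f: "apply_bcontfun (Bcontfun (f n)) = f n" for n
  proof (rule apply_Bcontfun[where b = 1])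
    show "continuous_on UNIV (f n)" unfolding f_def by (intro continuous_intros)
    have "0 \<le> real n * infdist x (- U)" for x
      by (intro mult_nonneg_nonneg infdist_nonneg of_nat_0_le_iff)
    then show "\<bar>f n x\<bar> \<le> 1" for x unfolding f_def by (smt (verit))
  qed
  have pos: "infdist x (- U) > 0" if "x \<in> U" for x
    using that assms False infdist_pos_not_in_closed[of "- U" x] by (auto simp: closed_Compl)
  show ?thesis
  proof (rule that[of "\<lambda>n. Bcontfun (f n)"], unfold f)
    fix n x
    show "0 \<le> f n x" by (simp add: f_def infdist_nonneg)
    show "f n x \<le> indicator U x"
      by (cases "x \<in> U") (auto simp: f_def)
    show "f n x \<le> f (Suc n) x"
      unfolding f_def by (intro min.mono order_refl mult_right_mono) (auto simp: infdist_nonneg)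
  next
    fix x
    show "(\<lambda>n. f n x) \<longlonglongrightarrow> indicator U x"
    proof (cases "x \<in> U")
      case True
      have "eventually (\<lambda>n. real n \<ge> 1 / infdist x (- U)) sequentially"
        using filterlim_real_sequentially by (simp add: filterlim_at_top)
      then have "eventually (\<lambda>n. f n x = 1) sequentially"
        by eventually_elim (use pos[OF True] in \<open>simp add: f_def min_absorb1 pos_divide_le_eq\<close>)
      then show ?thesis using True by (simp add: tendsto_eventually)
    qed (simp add: f_def)
  qed
qed

text \<open>The bounded continuous functions on a metric space carry the Daniell integral \<open>J\<close>: a positive
  linear functional that is continuous along sequences decreasing pointwise to \<open>0\<close>. No compactness
  is assumed, the continuity takes its place in the Riesz representation below.\<close>

locale daniell_functional =
  fixes J :: "('b::metric_space \<Rightarrow>\<^sub>C real) \<Rightarrow> real"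
  assumes lin: "linear J"
    and pos: "\<And>f. (\<And>x. 0 \<le> apply_bcontfun f x) \<Longrightarrow> 0 \<le> J f"
    and cont: "\<And>F. (\<And>n x. apply_bcontfun (F (Suc n)) x \<le> apply_bcontfun (F n) x) \<Longrightarrow>
        (\<And>x. (\<lambda>n. apply_bcontfun (F n) x) \<longlonglongrightarrow> 0) \<Longrightarrow> (\<lambda>n. J (F n)) \<longlonglongrightarrow> 0"
begin

lemmas J_simps = linear_add[OF lin] linear_diff[OF lin] linear_0[OF lin] linear_sum[OF lin]
  linear_scale[OF lin] linear_neg[OF lin]

lemma J_mono: "(\<And>x. apply_bcontfun f x \<le> apply_bcontfun g x) \<Longrightarrow> J f \<le> J g"
  using pos[of "g - f"] by (simp add: J_simps)

text \<open>The functions admitted in the definition of the content of an open set.\<close>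

definition below :: "'b set \<Rightarrow> ('b \<Rightarrow>\<^sub>C real) set" where
  "below U = {f. \<forall>x. 0 \<le> apply_bcontfun f x \<and> apply_bcontfun f x \<le> indicator U x}"

text \<open>The measure of an open set; on other sets the value has no meaning.\<close>

definition content :: "'b set \<Rightarrow> ennreal" where
  "content U = (SUP f\<in>below U. ennreal (J f))"

text \<open>The outer measure generated by the content of the open supersets.\<close>

definition outer :: "'b set \<Rightarrow> ennreal" where
  "outer A = (INF U\<in>{U. open U \<and> A \<subseteq> U}. content U)"

lemma below_0: "0 \<in> below U" by (auto simp: below_def indicator_def)

lemma content_upper: "f \<in> below U \<Longrightarrow> ennreal (J f) \<le> content U"
  unfolding content_def by (rule SUP_upper)

lemma content_mono: "U \<subseteq> V \<Longrightarrow> content U \<le> content V"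
  unfolding content_def
proof (rule SUP_subset_mono)
  assume "U \<subseteq> V"
  then have "indicator U x \<le> (indicator V x :: real)" for x by (auto simp: indicator_def)
  then show "below U \<subseteq> below V" 
    unfolding below_def by (blast intro: order_trans)
qed simp

lemma content_empty: "content {} = 0"
proof -
  have "f = 0" if "f \<in> below {}" for f
    using that by (intro bcontfun_eqI) (auto simp: below_def intro: antisym)
  then have "below {} = {0}" using below_0 by blast
  then show ?thesis by (simp add: content_def J_simps)
qed

lemma content_UNIV: "content UNIV = ennreal (J (const_bcontfun 1))"
  unfolding content_def
proof (rule antisym[OF SUP_least SUP_upper])
  fix f assume "f \<in> below UNIV"
  then show "ennreal (J f) \<le> ennreal (J (const_bcontfun 1))"
    by (intro ennreal_leI J_mono) (auto simp: below_def)
qed (simp add: below_def)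

text \<open>The only place where the continuity of \<open>J\<close> along decreasing sequences enters.\<close>

lemma content_UN_le:
  fixes A :: "nat \<Rightarrow> 'b set"
  assumes A: "\<And>i. open (A i)"
  shows "content (\<Union>i. A i) \<le> (\<Sum>i. content (A i))"
  unfolding content_def[of "\<Union>i. A i"]
proof (rule SUP_least)
  fix f assume f: "f \<in> below (\<Union>i. A i)"
  have "\<exists>b :: nat \<Rightarrow> 'b \<Rightarrow>\<^sub>C real. (\<forall>n x. 0 \<le> b n x) \<and> (\<forall>n x. b n x \<le> indicator (A i) x) \<and>
      (\<forall>n x. b n x \<le> b (Suc n) x) \<and> (\<forall>x. (\<lambda>n. b n x) \<longlonglongrightarrow> indicator (A i) x)" for i
    using open_indicator_approx[OF A[of i]] by metis
  then obtain b :: "nat \<Rightarrow> nat \<Rightarrow> 'b \<Rightarrow>\<^sub>C real" where b: "\<And>i n x. 0 \<le> b i n x"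
    "\<And>i n x. b i n x \<le> indicator (A i) x" "\<And>i n x. b i n x \<le> b i (Suc n) x"
    "\<And>i x. (\<lambda>n. b i n x) \<longlonglongrightarrow> indicator (A i) x" by metis
  define s where "s k = (\<Sum>i<k. b i k)" for k
  have s: "s k x = (\<Sum>i<k. b i k x)" for k x by (simp add: s_def sum_apply_bcontfun)
  \<comment> \<open>\<open>r k\<close> is what the bumps of the first \<open>k\<close> sets leave uncovered of \<open>f\<close>; it decreases to \<open>0\<close>.\<close>
  define r where "r k x = max 0 (f x - s k x)" for k x
  have fb: "0 \<le> f x" "f x \<le> 1" "x \<notin> (\<Union>i. A i) \<Longrightarrow> f x = 0" for x
  proof -
    have "0 \<le> f x \<and> f x \<le> indicator (\<Union>i. A i) x" using f by (simp add: below_def)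
    then show "0 \<le> f x" "f x \<le> 1" "x \<notin> (\<Union>i. A i) \<Longrightarrow> f x = 0"
      by (auto intro: order_trans[OF _ indicator_le_1])
  qed
  have s0: "0 \<le> s k x" for k x unfolding s using b by (intro sum_nonneg) auto
  have sinc: "s k x \<le> s (Suc k) x" for k x
  proof -
    have "s k x \<le> (\<Sum>i<k. b i (Suc k) x)" unfolding s using b by (intro sum_mono)
    also have "\<dots> \<le> s (Suc k) x" unfolding s using b by simp
    finally show ?thesis .
  qed
  have r: "apply_bcontfun (Bcontfun (r k)) = r k" for k
  proof (rule apply_Bcontfun[where b = 1])
    show "continuous_on UNIV (r k)" unfolding r_def by (intro continuous_intros)
    show "\<bar>r k x\<bar> \<le> 1" for x using fb(1,2)[of x] s0[of k x] by (simp add: r_def)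
  qed
  have "(\<lambda>k. J (Bcontfun (r k))) \<longlonglongrightarrow> 0"
  proof (rule cont, unfold r)
    fix k x
    show "r (Suc k) x \<le> r k x" using sinc[of k x] by (simp add: r_def)
  next
    fix x
    show "(\<lambda>k. r k x) \<longlonglongrightarrow> 0"
    proof (cases "x \<in> (\<Union>i. A i)")
      case True
      then obtain i where i: "x \<in> A i" by blast
      have "(\<lambda>k. 1 - b i k x) \<longlonglongrightarrow> 1 - 1"
        using b(4)[of i x] i by (intro tendsto_intros) simp
      then have t: "(\<lambda>k. 1 - b i k x) \<longlonglongrightarrow> 0" by simp
      have le: "r k x \<le> 1 - b i k x" if "k \<ge> Suc i" for k
      proof -
        have "b i k x \<le> s k x" unfolding s using b that by (intro member_le_sum) auto
        moreover have "b i k x \<le> 1" using b(2)[of i k x] i by simp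
        ultimately show ?thesis using fb(2)[of x] by (simp add: r_def)
      qed
      show ?thesis
      proof (rule tendsto_sandwich[OF _ _ tendsto_const t])
        show "\<forall>\<^sub>F k in sequentially. 0 \<le> r k x" by (simp add: r_def)
        show "\<forall>\<^sub>F k in sequentially. r k x \<le> 1 - b i k x"
          using le by (rule eventually_sequentiallyI)
      qed
    next
      case False
      then have "r k x = 0" for k using fb s0[of k x] by (simp add: r_def)
      then show ?thesis by simp
    qed
  qed
  then have "(\<lambda>k. J f - J (Bcontfun (r k))) \<longlonglongrightarrow> J f - 0" by (intro tendsto_intros)
  then have lim: "(\<lambda>k. ennreal (J f - J (Bcontfun (r k)))) \<longlonglongrightarrow> ennreal (J f)"
    by (intro tendsto_ennrealI) simp
  have "ennreal (J f - J (Bcontfun (r k))) \<le> (\<Sum>i. content (A i))" for k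
  proof -
    have "J f - J (Bcontfun (r k)) = J (f - Bcontfun (r k))" by (simp add: J_simps)
    also have "\<dots> \<le> J (s k)"
      by (intro J_mono) (simp add: r, simp add: r_def)
    also have "\<dots> = (\<Sum>i<k. J (b i k))" by (simp add: s_def J_simps)
    finally have "ennreal (J f - J (Bcontfun (r k))) \<le> ennreal (\<Sum>i<k. J (b i k))"
      by (rule ennreal_leI)
    also have "\<dots> = (\<Sum>i<k. ennreal (J (b i k)))"
      using b by (intro sum_ennreal[symmetric] pos)
    also have "\<dots> \<le> (\<Sum>i<k. content (A i))"
      using b by (intro sum_mono content_upper) (auto simp: below_def)
    also have "\<dots> \<le> (\<Sum>i. content (A i))" by (rule sum_le_suminf) auto
    finally show ?thesis .
  qed
  then show "ennreal (J f) \<le> (\<Sum>i. content (A i))"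
    by (intro LIMSEQ_le_const2[OF lim]) auto
qed

lemma outer_open: "open U \<Longrightarrow> outer U = content U"
  unfolding outer_def by (rule antisym[OF INF_lower INF_greatest]) (auto intro: content_mono)

lemma outer_le: "open U \<Longrightarrow> A \<subseteq> U \<Longrightarrow> outer A \<le> content U"
  unfolding outer_def by (rule INF_lower) auto

lemma outer_mono: "A \<subseteq> B \<Longrightarrow> outer A \<le> outer B"
  unfolding outer_def by (rule INF_superset_mono) auto

lemma outer_UN_le:
  fixes A :: "nat \<Rightarrow> 'b set"
  shows "outer (\<Union>i. A i) \<le> (\<Sum>i. outer (A i))"
proof (rule ennreal_le_epsilon)
  fix e :: real assume e: "0 < e" and "(\<Sum>i. outer (A i)) < top"
  then have *: "outer (A n) < outer (A n) + e * (1/2)^Suc n" for n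
    by (auto simp add: less_top dest!: ennreal_suminf_lessD)
  have "\<exists>U. open U \<and> A n \<subseteq> U \<and> content U \<le> outer (A n) + e * (1/2)^Suc n" for n
    using *[of n] unfolding outer_def INF_less_iff by (auto intro: less_imp_le)
  then obtain U where U: "\<And>n. open (U n)" "\<And>n. A n \<subseteq> U n"
    "\<And>n. content (U n) \<le> outer (A n) + e * (1/2)^Suc n" by metis
  have "outer (\<Union>i. A i) \<le> content (\<Union>i. U i)" using U by (intro outer_le) auto
  also have "\<dots> \<le> (\<Sum>n. content (U n))" using U by (intro content_UN_le)
  also have "\<dots> \<le> (\<Sum>n. outer (A n) + e * (1/2) ^ Suc n)"
    using U by (intro suminf_le) auto
  also have "\<dots> = (\<Sum>n. outer (A n)) + (\<Sum>n. ennreal e * ennreal ((1/2) ^ Suc n))"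
    using \<open>0 < e\<close> by (subst suminf_add[symmetric])
      (auto simp del: ennreal_suminf_cmult simp add: ennreal_mult[symmetric])
  also have "\<dots> = (\<Sum>n. outer (A n)) + e"
    unfolding ennreal_suminf_cmult
    by (subst suminf_ennreal_eq[OF zero_le_power power_half_series]) auto
  finally show "outer (\<Union>i. A i) \<le> (\<Sum>i. outer (A i)) + e" .
qed

lemma outer_measure_space_outer: "outer_measure_space UNIV outer"
  unfolding outer_measure_space_def
  by (auto simp: positive_def increasing_def countably_subadditive_def outer_open content_empty
      intro: outer_mono outer_UN_le)

lemma outer_Un_le: "outer (A \<union> B) \<le> outer A + outer B"
proof -
  have "subadditive UNIV outer"
    using ring_of_sets.countably_subadditive_subadditive[OF ring_of_sets_Pow, of UNIV outer]
      outer_measure_space_outer by (simp add: outer_measure_space_def)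
  then have "outer (A \<union> (B - A)) \<le> outer A + outer (B - A)"
    by (rule subadditiveD) auto
  also have "\<dots> \<le> outer A + outer B" by (intro add_left_mono outer_mono) blast
  finally show ?thesis by simp
qed

text \<open>The nontrivial half of Caratheodory's criterion for an open set \<open>U\<close>. If \<open>f\<close> is admitted for
  \<open>W \<inter> U\<close> and \<open>g\<close> for the open neighbourhood \<open>W \<inter> {f < \<delta>}\<close> of \<open>X - U\<close>, then \<open>max 0 (f - \<delta>) + g\<close> is
  admitted for \<open>W\<close>, because the two summands have disjoint supports.\<close>

lemma content_split:
  assumes W: "open W" "X \<subseteq> W" and U: "open U"
  shows "outer (X \<inter> U) + outer (X - U) \<le> content W"
proof -
  have "ennreal (J f) + outer (X - U) \<le> content W" if f: "f \<in> below (W \<inter> U)" for f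
  proof (rule ennreal_le_epsilon)
    fix e :: real assume e: "0 < e"
    have fb: "0 \<le> f x" "f x \<le> indicator (W \<inter> U) x" for x using f by (auto simp: below_def)
    define c where "c = J (const_bcontfun 1)"
    have c0: "0 \<le> c" unfolding c_def by (rule pos) simp
    define \<delta> where "\<delta> = e / (c + 1)"
    have \<delta>: "\<delta> > 0" "\<delta> * c \<le> e" using e c0 by (auto simp: \<delta>_def field_simps)
    define V where "V = W \<inter> {x. f x < \<delta>}"
    have "open V" unfolding V_def using W by (intro open_Int open_Collect_less continuous_intros) auto
    moreover have "X - U \<subseteq> V"
    proof
      fix x assume x: "x \<in> X - U"
      then have "f x = 0" using fb[of x] by (auto simp: indicator_def)
      then show "x \<in> V" using x W \<delta> by (auto simp: V_def)
    qed
    ultimately have 1: "outer (X - U) \<le> content V" by (rule outer_le)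
    have 2: "ennreal (J f) + ennreal (J g) \<le> content W + e" if g: "g \<in> below V" for g
    proof -
      have gb: "0 \<le> g x" "g x \<le> indicator V x" for x using g by (auto simp: below_def)
      define h where "h x = max 0 (f x - \<delta>)" for x
      have f1: "f x \<le> 1" for x using fb(2)[of x] indicator_le_1 by (rule order_trans)
      have h: "apply_bcontfun (Bcontfun h) = h"
      proof (rule apply_Bcontfun[where b = 1])
        show "continuous_on UNIV h" unfolding h_def by (intro continuous_intros)
        show "\<bar>h x\<bar> \<le> 1" for x using f1[of x] \<delta>(1) by (simp add: h_def)
      qed
      have "Bcontfun h + g \<in> below W"
        unfolding below_def
      proof (intro CollectI allI)
        fix x
        have "h x + g x \<le> indicator W x"
        proof (cases "x \<in> V")
          case True
          then have "h x = 0" "x \<in> W" by (auto simp: V_def h_def)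
          then show ?thesis using gb(2)[of x] True by simp
        next
          case False
          then have "g x = 0" using gb[of x] by simp
          moreover have "h x \<le> f x" using fb(1)[of x] \<delta> by (simp add: h_def)
          moreover have "f x \<le> indicator W x" using fb(2)[of x]
            by (rule order_trans) (auto simp: indicator_def)
          ultimately show ?thesis by simp
        qed
        then show "0 \<le> apply_bcontfun (Bcontfun h + g) x \<and> apply_bcontfun (Bcontfun h + g) x \<le> indicator W x"
          using gb(1)[of x] by (simp add: h, simp add: h_def)
      qed
      then have "ennreal (J (Bcontfun h + g)) \<le> content W" by (rule content_upper)
      moreover have "J f \<le> J (Bcontfun h) + \<delta> * c"
      proof -
        have "J f \<le> J (Bcontfun h + \<delta> *\<^sub>R const_bcontfun 1)"
          by (rule J_mono) (simp add: h, simp add: h_def)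
        then show ?thesis by (simp add: J_simps c_def)
      qed
      then have "J f + J g \<le> J (Bcontfun h + g) + e" using \<delta> by (simp add: J_simps)
      then have "ennreal (J f + J g) \<le> ennreal (J (Bcontfun h + g) + e)" by (rule ennreal_leI)
      moreover have "0 \<le> J f" "0 \<le> J g" "0 \<le> J (Bcontfun h)"
        using fb gb by (auto intro!: pos simp: h) (simp add: h_def)
      moreover have "J (Bcontfun h + g) = J (Bcontfun h) + J g" by (simp add: J_simps)
      ultimately have *: "ennreal (J f) + ennreal (J g) \<le> ennreal (J (Bcontfun h + g)) + ennreal e"
        using e by (simp add: ennreal_plus flip: ennreal_plus)
      show ?thesis
        by (rule order_trans[OF *]) (intro add_right_mono content_upper \<open>Bcontfun h + g \<in> below W\<close>)
    qed
    have ne: "below V \<noteq> {}" using below_0 by blast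
    have "ennreal (J f) + content V = (SUP g\<in>below V. ennreal (J f) + ennreal (J g))"
      unfolding content_def by (simp add: ennreal_SUP_add_right[OF ne])
    also have "\<dots> \<le> content W + e" using 2 by (rule SUP_least)
    finally show "ennreal (J f) + outer (X - U) \<le> content W + e"
      using 1 by (meson add_left_mono order_trans)
  qed note 1 = this
  have ne: "below (W \<inter> U) \<noteq> {}" using below_0 by blast
  have "outer (X \<inter> U) + outer (X - U) \<le> content (W \<inter> U) + outer (X - U)"
    using W U by (intro add_right_mono outer_le) auto
  also have "\<dots> = (SUP f\<in>below (W \<inter> U). ennreal (J f) + outer (X - U))"
    unfolding content_def by (simp add: ennreal_SUP_add_left[OF ne])
  also have "\<dots> \<le> content W" using 1 by (rule SUP_least)
  finally show ?thesis .
qed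

lemma open_in_lambda_system:
  assumes "open U" shows "U \<in> lambda_system UNIV UNIV outer"
proof -
  have "outer (X \<inter> U) + outer (X - U) = outer X" for X
  proof (rule antisym)
    show "outer (X \<inter> U) + outer (X - U) \<le> outer X"
      unfolding outer_def[of X] using content_split assms by (intro INF_greatest) auto
    have "X = (X \<inter> U) \<union> (X - U)" by blast
    then show "outer X \<le> outer (X \<inter> U) + outer (X - U)" using outer_Un_le by metis
  qed
  then show ?thesis
    by (auto simp: lambda_system_def Int_commute Diff_eq)
qed

text \<open>The measure that represents \<open>J\<close>.\<close>

definition riesz :: "'b measure" where
  "riesz = measure_of UNIV (sets borel) outer"

lemma sets_riesz [simp]: "sets riesz = sets borel" 
  and space_riesz [simp]: "space riesz = UNIV"
  unfolding riesz_def using sets.sets_measure_of_eq[of borel] by (simp_all add: space_borel[symmetric] del: space_borel)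

lemma measurable_riesz [simp]: "measurable riesz = measurable borel"
  by (intro ext measurable_cong_sets) auto

lemma emeasure_riesz: "A \<in> sets borel \<Longrightarrow> emeasure riesz A = outer A"
proof -
  assume A: "A \<in> sets borel"
  have ms: "measure_space UNIV (lambda_system UNIV UNIV outer) outer"
    using sigma_algebra.caratheodory_lemma[OF sigma_algebra_Pow[of UNIV]] outer_measure_space_outer
    by simp
  then have sa: "sigma_algebra UNIV (lambda_system UNIV UNIV outer)" by (simp add: measure_space_def)
  have sub: "sets borel \<subseteq> lambda_system UNIV UNIV outer"
    unfolding borel_def using open_in_lambda_system
    by (simp add: sets_measure_of) (rule sigma_algebra.sigma_sets_subset[OF sa], auto)
  have sb: "sigma_algebra UNIV (sets (borel :: 'b measure))"
    using sets.sigma_algebra_axioms[of "borel :: 'b measure"] by simp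
  have "measure_space UNIV (sets borel) outer"
    by (rule measure_down[OF ms sb sub])
  then show ?thesis
    unfolding riesz_def using A by (intro emeasure_measure_of_sigma) (auto simp: measure_space_def)
qed

lemma emeasure_riesz_open: "open U \<Longrightarrow> emeasure riesz U = content U"
  by (simp add: emeasure_riesz outer_open)

lemma emeasure_riesz_UNIV: "emeasure riesz UNIV = ennreal (J (const_bcontfun 1))"
  by (simp add: emeasure_riesz_open content_UNIV)

sublocale riesz: finite_measure riesz
  by (rule finite_measureI) (simp add: emeasure_riesz_UNIV)

lemma measure_riesz_UNIV: "measure riesz UNIV = J (const_bcontfun 1)"
  by (rule measure_eq_emeasure_eq_ennreal[OF _ emeasure_riesz_UNIV]) (rule pos, simp)

lemma integrable_riesz: "integrable riesz (apply_bcontfun f :: 'b \<Rightarrow> real)"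
proof (rule riesz.integrable_const_bound[where B = "norm f"])
  show "AE x in riesz. norm (apply_bcontfun f x) \<le> norm f" by (rule AE_I2) (rule norm_bounded)
  show "apply_bcontfun f \<in> borel_measurable riesz" by simp
qed

lemma J_le_integral_01:
  fixes f :: "'b \<Rightarrow>\<^sub>C real"
  assumes f: "\<And>x. 0 \<le> f x" "\<And>x. f x \<le> 1"
  shows "J f \<le> (LINT x|riesz. f x)"
proof (rule field_le_epsilon)
  fix e :: real assume e: "e > 0"
  define c where "c = measure riesz UNIV"
  obtain n where n: "real n > c / e" "n > 0"
  proof -
    obtain n where n: "max 1 (c / e) < real n" using reals_Archimedean2 by metis
    show ?thesis by (rule that[of n]) (use n in simp_all)
  qed
  \<comment> \<open>The slice of \<open>f\<close> between the heights \<open>k / n\<close> and \<open>(k + 1) / n\<close>, which is at most \<open>1 / n\<close> times the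
    indicator of the open set \<open>{f > k / n}\<close>. There are at most \<open>n f + 1\<close> such sets around a point.\<close>
  define g where "g k x = min (f x) (real (Suc k) / n) - min (f x) (real k / n)" for k x
  define U where "U k = {x. real k / n < f x}" for k
  have openU: "open (U k)" for k
    unfolding U_def by (intro open_Collect_less continuous_intros)
  have g01: "0 \<le> g k x" "real n * g k x \<le> indicator (U k) x" for k x
  proof -
    have "real k / n \<le> real (Suc k) / n" by (simp add: divide_right_mono)
    then show "0 \<le> g k x" by (auto simp: g_def)
    show "real n * g k x \<le> indicator (U k) x"
    proof (cases "x \<in> U k")
      case True
      then have "g k x \<le> real (Suc k) / n - real k / n" by (auto simp: g_def U_def)
      also have "\<dots> = 1 / n" using n by (simp add: field_simps)
      finally show ?thesis using n True by (simp add: field_simps)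
    next
      case False
      then have "f x \<le> real k / n" by (simp add: U_def)
      moreover have "real k / n \<le> real (Suc k) / n" by (simp add: divide_right_mono)
      ultimately have "g k x = 0" by (simp add: g_def)
      then show ?thesis by simp
    qed
  qed
  have g: "apply_bcontfun (Bcontfun (g k)) = g k" for k
  proof (rule apply_Bcontfun[where b = 1])
    show "continuous_on UNIV (g k)" unfolding g_def using n by (intro continuous_intros) auto
    fix x
    have "g k x \<le> real n * g k x" using n g01(1)[of k x] by (simp add: mult_le_cancel_right1)
    also have "\<dots> \<le> 1" using g01(2)[of k x] indicator_le_1 by (rule order_trans)
    finally show "\<bar>g k x\<bar> \<le> 1" using g01(1)[of k x] by simp
  qed
  have sumg: "(\<Sum>k<n. g k x) = f x" for x
  proof -
    have "(\<Sum>k<n. g k x) = min (f x) (real n / n) - min (f x) (real 0 / n)"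
      unfolding g_def by (rule sum_lessThan_telescope)
    then show ?thesis using f[of x] n by simp
  qed
  have fin: "J (Bcontfun (g k)) \<le> measure riesz (U k) / n" for k
  proof -
    have "n *\<^sub>R Bcontfun (g k) \<in> below (U k)" using g01 by (auto simp: below_def g)
    then have "ennreal (J (n *\<^sub>R Bcontfun (g k))) \<le> emeasure riesz (U k)"
      using openU by (simp add: emeasure_riesz_open content_upper)
    then have "J (n *\<^sub>R Bcontfun (g k)) \<le> measure riesz (U k)"
      by (simp add: riesz.emeasure_eq_measure)
    then show ?thesis using n by (simp add: J_simps field_simps)
  qed
  have int: "integrable riesz (\<lambda>x. indicator (U k) x / n :: real)" for k
  proof (rule integrable_divide_zero)
    show "integrable riesz (indicator (U k) :: 'b \<Rightarrow> real)"
      using openU by (intro integrable_real_indicator) (auto simp: less_top[symmetric])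
  qed
  have "f = (\<Sum>k<n. Bcontfun (g k))"
    by (rule bcontfun_eqI) (simp add: sum_apply_bcontfun g sumg)
  then have "J f = (\<Sum>k<n. J (Bcontfun (g k)))" by (simp add: J_simps)
  also have "\<dots> \<le> (\<Sum>k<n. measure riesz (U k) / n)" by (intro sum_mono fin)
  also have "\<dots> = (LINT x|riesz. (\<Sum>k<n. indicator (U k) x / n))"
    using int by (subst Bochner_Integration.integral_sum) auto
  also have "\<dots> \<le> (LINT x|riesz. apply_bcontfun f x + 1 / real n)"
  proof (rule integral_mono)
    show "integrable riesz (\<lambda>x. \<Sum>k<n. indicator (U k) x / n :: real)"
      using int by (intro Bochner_Integration.integrable_sum)
    show "integrable riesz (\<lambda>x. apply_bcontfun f x + 1 / real n)"
      using integrable_riesz by simp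
    fix x
    have "(\<Sum>k<n. indicator (U k) x :: real) = real (card {k\<in>{..<n}. x \<in> U k})"
      by (simp add: sum.If_cases indicator_def Int_def)
    also have "\<dots> \<le> real (card {..<nat \<lceil>real n * apply_bcontfun f x\<rceil>})"
    proof (intro of_nat_mono card_mono)
      show "{k \<in> {..<n}. x \<in> U k} \<subseteq> {..<nat \<lceil>real n * apply_bcontfun f x\<rceil>}"
        using n by (auto simp: U_def field_simps zless_nat_eq_int_zless less_ceiling_iff)
    qed auto
    also have "\<dots> \<le> real n * apply_bcontfun f x + 1" using f(1)[of x] n by simp
    finally show "(\<Sum>k<n. indicator (U k) x / n) \<le> apply_bcontfun f x + 1 / real n"
      using n by (simp add: sum_divide_distrib[symmetric] field_simps)
  qed
  also have "\<dots> = (LINT x|riesz. f x) + c / real n"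
    using integrable_riesz[of f] by (simp add: c_def)
  also have "\<dots> \<le> (LINT x|riesz. f x) + e"
    using n e by (simp add: field_simps)
  finally show "J f \<le> (LINT x|riesz. f x) + e" .
qed

text \<open>One inequality suffices: applied to \<open>- f\<close> it gives the other one.\<close>

lemma J_le_integral: "J f \<le> (LINT x|riesz. apply_bcontfun f x)"
proof -
  define c where "c = norm f + 1"
  have c: "c > 0" "\<bar>f x\<bar> \<le> c" for x
    using norm_bounded[of f x] by (auto simp: c_def add_nonneg_pos)
  define g where "g = (1 / (2 * c)) *\<^sub>R (f + const_bcontfun c)"
  have "J g \<le> (LINT x|riesz. g x)"
  proof (rule J_le_integral_01)
    fix x
    show "0 \<le> g x" "g x \<le> 1"
      using c(1) c(2)[of x] by (auto simp: g_def field_simps abs_le_iff)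
  qed
  also have "(LINT x|riesz. g x) = ((LINT x|riesz. f x) + c * measure riesz UNIV) / (2 * c)"
    using integrable_riesz[of f] by (simp add: g_def)
  also have "J g = (J f + J (c *\<^sub>R const_bcontfun 1)) / (2 * c)"
  proof -
    have "const_bcontfun c = c *\<^sub>R (const_bcontfun 1 :: 'b \<Rightarrow>\<^sub>C real)" by (rule bcontfun_eqI) simp
    then show ?thesis by (simp add: g_def J_simps)
  qed
  finally show ?thesis using c(1) by (simp add: J_simps measure_riesz_UNIV divide_le_cancel)
qed

theorem J_eq_integral: "J f = (LINT x|riesz. apply_bcontfun f x)"
  using J_le_integral[of f] J_le_integral[of "- f"] integrable_riesz[of f] by (simp add: J_simps)

end

section \<open>Semicontinuous functions and Borel measures on metric spaces\<close>

text \<open>The Lipschitz regularizations \<open>f n x = inf {h y + n * dist x y}\<close> of a lower semicontinuous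
  function that is bounded below increase to it; they are truncated at \<open>c + n\<close> to be bounded.\<close>

lemma lsc_approx:
  fixes h :: "'b::metric_space \<Rightarrow> real"
  assumes lsc: "\<And>a. open {x. a < h x}" and low: "\<And>x. c \<le> h x"
  obtains v :: "nat \<Rightarrow> 'b \<Rightarrow>\<^sub>C real" where
    "\<And>n x. v n x \<le> v (Suc n) x" "\<And>n x. c \<le> v n x" "\<And>n x. v n x \<le> h x"
    "\<And>x. (\<lambda>n. v n x) \<longlonglongrightarrow> h x"
proof -
  define f where "f n x = (INF y. h y + real n * dist x y)" for n x
  have bdd: "bdd_below (range (\<lambda>y. h y + real n * dist x y))" for n x
  proof (rule bdd_belowI2[where m = c])
    fix y
    have "0 \<le> real n * dist x y" by simp
    then show "c \<le> h y + real n * dist x y" using low[of y] by linarith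
  qed
  have fle: "f n x \<le> h y + real n * dist x y" for n x y
    unfolding f_def using bdd by (rule cINF_lower) simp
  have fge: "b \<le> f n x" if "\<And>y. b \<le> h y + real n * dist x y" for b n x
    unfolding f_def using that by (intro cINF_greatest) auto
  have fc: "c \<le> f n x" for n x
  proof (rule fge)
    fix y
    have "0 \<le> real n * dist x y" by simp
    then show "c \<le> h y + real n * dist x y" using low[of y] by linarith
  qed
  have fh: "f n x \<le> h x" for n x using fle[of n x x] by simp
  have finc: "f n x \<le> f (Suc n) x" for n x
  proof (rule fge)
    fix y
    have "real n * dist x y \<le> real (Suc n) * dist x y" by (intro mult_right_mono) auto
    then show "f n x \<le> h y + real (Suc n) * dist x y" using fle[of n x y] by linarith
  qed
  have lip: "f n x - real n * dist x x' \<le> f n x'" for n x x'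
  proof (rule fge)
    fix y
    have "real n * dist x y \<le> real n * (dist x x' + dist x' y)"
      by (intro mult_left_mono dist_triangle) simp
    then show "f n x - real n * dist x x' \<le> h y + real n * dist x' y"
      using fle[of n x y] by (simp add: algebra_simps)
  qed
  have "continuous_on UNIV (f n)" for n
  proof (rule lipschitz_on_continuous_on[of "real n"], rule lipschitz_onI)
    fix x x'
    show "dist (f n x) (f n x') \<le> real n * dist x x'"
      using lip[of n x x'] lip[of n x' x] by (simp add: dist_real_def dist_commute)
  qed simp
  note cont = this
  define v where "v n x = min (c + real n) (f n x)" for n x
  have v: "apply_bcontfun (Bcontfun (v n)) = v n" for n
  proof (rule apply_Bcontfun[where b = "\<bar>c\<bar> + real n"])
    show "continuous_on UNIV (v n)" unfolding v_def by (intro continuous_intros cont)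
    show "\<bar>v n x\<bar> \<le> \<bar>c\<bar> + real n" for x using fc[of n x] by (simp add: v_def)
  qed
  show ?thesis
  proof (rule that[of "\<lambda>n. Bcontfun (v n)"], unfold v)
    fix n x
    show "v n x \<le> v (Suc n) x" unfolding v_def by (intro min.mono finc) simp
    show "c \<le> v n x" using fc[of n x] by (simp add: v_def)
    show "v n x \<le> h x" using fh[of n x] by (simp add: v_def)
  next
    fix x
    show "(\<lambda>n. v n x) \<longlonglongrightarrow> h x"
    proof (rule LIMSEQ_I)
      fix e :: real assume e: "0 < e"
      have "x \<in> {y. h x - e / 2 < h y}" using e by simp
      then obtain r where r: "r > 0" "\<And>y. dist y x < r \<Longrightarrow> h x - e / 2 < h y"
        using lsc[of "h x - e / 2"] unfolding open_dist by blast
      obtain N where N: "max (h x - c) ((h x - c) / r) < real N"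
        using reals_Archimedean2 by blast
      have "norm (v n x - h x) < e" if n: "n \<ge> N" for n
      proof -
        have n1: "h x - c < real n" "(h x - c) / r < real n" using N n by auto
        have "h x - e / 2 \<le> f n x"
        proof (rule fge)
          fix y
          show "h x - e / 2 \<le> h y + real n * dist x y"
          proof (cases "dist y x < r")
            case True
            moreover have "0 \<le> real n * dist x y" by simp
            ultimately show ?thesis using r(2)[of y] by linarith
          next
            case False
            have "h x - c \<le> real n * r" using n1 r(1) by (simp add: field_simps)
            also have "\<dots> \<le> real n * dist x y"
              using False by (intro mult_left_mono) (auto simp: dist_commute)
            finally show ?thesis using low[of y] e by linarith
          qed
        qed
        then show ?thesis using fh[of n x] n1(1) e by (simp add: v_def)
      qed
      then show "\<exists>N. \<forall>n\<ge>N. norm (v n x - h x) < e" by blast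
    qed
  qed
qed

lemma measure_eqI_bcontfun:
  fixes M N :: "'b::metric_space measure"
  assumes sets: "sets M = sets borel" "sets N = sets borel"
    and fin: "finite_measure M" "finite_measure N"
    and eq: "\<And>f :: 'b \<Rightarrow>\<^sub>C real. (LINT x|M. f x) = (LINT x|N. f x)"
  shows "M = N"
proof (rule measure_eqI_generator_eq[where E = "{S. open S}" and \<Omega> = UNIV and A = "\<lambda>_. UNIV"])
  interpret M: finite_measure M by fact
  interpret N: finite_measure N by fact
  show "sets M = sigma_sets UNIV {S. open S}" "sets N = sigma_sets UNIV {S. open S}"
    using sets by (simp_all add: borel_def)
  fix U :: "'b set" assume "U \<in> {S. open S}"
  then have U: "open U" by simp
  then obtain b :: "nat \<Rightarrow> 'b \<Rightarrow>\<^sub>C real" where b: "\<And>n x. 0 \<le> b n x" "\<And>n x. b n x \<le> indicator U x"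
    "\<And>x. (\<lambda>n. b n x) \<longlonglongrightarrow> indicator U x"
    by (rule open_indicator_approx) blast
  have lim: "(\<lambda>n. LINT x|K. b n x) \<longlonglongrightarrow> measure K U" if K: "sets K = sets borel" "finite_measure K" for K
  proof -
    interpret K: finite_measure K by fact
    have m: "measurable K borel = measurable borel borel" by (rule measurable_cong_sets[OF K(1) refl])
    have "(\<lambda>n. LINT x|K. b n x) \<longlonglongrightarrow> (LINT x|K. indicator U x)"
    proof (rule integral_dominated_convergence[where w = "\<lambda>_. 1"])
      show "AE x in K. norm (b i x) \<le> 1" for i
        using b(1)[of i] order_trans[OF b(2)[of i] indicator_le_1] by simp
    qed (use b U in \<open>simp_all add: m\<close>)
    moreover have "U \<in> sets K" using U K(1) by simp
    ultimately show ?thesis using sets_eq_imp_space_eq[OF K(1)] by simp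
  qed
  have "measure M U = measure N U"
    using lim[OF sets(1) fin(1)] lim[OF sets(2) fin(2)] unfolding eq by (rule LIMSEQ_unique)
  then show "emeasure M U = emeasure N U" by (simp add: M.emeasure_eq_measure N.emeasure_eq_measure)
next
  show "emeasure M UNIV \<noteq> \<infinity>" using finite_measure.emeasure_finite[OF fin(1)] by simp
qed (auto simp: Int_stable_def)

section \<open>Measurability and growth on path space\<close>

lemma restrict_mem_paths [simp]: "restrict s {..t} \<in> paths t"
  by (simp add: paths_def)

lemma restrict_paths [simp]: "s \<in> paths t \<Longrightarrow> restrict s {..t} = s"
  by (auto simp: paths_def PiE_def extensional_restrict)

lemma space_path_borel [simp]: "space (path_borel t) = paths t"
  by (simp add: path_borel_def paths_def space_PiM)

text \<open>The full space of sequences is a metric space of the type class, whereas \<open>paths t\<close> is only a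
  subset of it. The map \<open>s \<mapsto> restrict s {..t}\<close> onto \<open>paths t\<close> transfers continuity, semicontinuity
  and measurability between the two.\<close>

lemma continuous_on_restrict_UNIV:
  "continuous_on UNIV (\<lambda>s :: nat \<Rightarrow> 'a::euclidean_space. restrict s {..t})"
proof (rule continuous_on_coordinatewise_then_product)
  fix i
  show "continuous_on UNIV (\<lambda>s :: nat \<Rightarrow> 'a. restrict s {..t} i)"
    by (cases "i \<le> t") (auto simp: restrict_def)
qed

lemma open_restrict_vimage:
  fixes U :: "(nat \<Rightarrow> 'a::euclidean_space) set"
  assumes "openin (path_top t) U"
  shows "open {s. restrict s {..t} \<in> U}"
proof -
  have "continuous_map (product_topology (\<lambda>_. euclidean) UNIV) (path_top t)
      (\<lambda>s :: nat \<Rightarrow> 'a. restrict s {..t})"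
    unfolding path_top_def continuous_map_componentwise
  proof (intro conjI ballI)
    fix i assume "i \<in> {..t}"
    then have eq: "(\<lambda>s :: nat \<Rightarrow> 'a. restrict s {..t} i) = (\<lambda>s. s i)" by auto
    show "continuous_map (product_topology (\<lambda>_. euclidean) UNIV) euclidean
        (\<lambda>s :: nat \<Rightarrow> 'a. restrict s {..t} i)"
      unfolding eq by (rule continuous_map_product_projection) simp
  qed auto
  then have "openin (product_topology (\<lambda>_. euclidean) UNIV)
      {s \<in> topspace (product_topology (\<lambda>_. euclidean) UNIV). restrict s {..t} \<in> U}"
    using assms by (rule openin_continuous_map_preimage)
  then show ?thesis by (simp add: euclidean_product_topology)
qed

lemma measurable_restrict_borel [measurable]:
  "(\<lambda>s :: nat \<Rightarrow> 'a::euclidean_space. restrict s {..t}) \<in> measurable borel (path_borel t)"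
proof -
  have "(\<lambda>s. restrict s {..t}) \<in> measurable (PiM UNIV (\<lambda>_. borel :: 'a measure)) (path_borel t)"
    unfolding path_borel_def by (rule measurable_restrict_subset) simp
  then show ?thesis using measurable_cong_sets[OF sets_PiM_equal_borel refl] by blast
qed

lemma measurable_restrict_path [measurable (raw)]:
  "t \<le> T \<Longrightarrow> (\<lambda>s :: nat \<Rightarrow> 'a::euclidean_space. restrict s {..t}) \<in> measurable (path_borel T) (path_borel t)"
  unfolding path_borel_def by (rule measurable_restrict_subset) simp

lemma measurable_path_to_borel:
  "(\<lambda>s. s) \<in> measurable (path_borel t) (borel :: (nat \<Rightarrow> 'a::euclidean_space) measure)"
proof -
  have "(\<lambda>s. s) \<in> measurable (path_borel t) (PiM UNIV (\<lambda>_. borel :: 'a measure))"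
  proof (rule measurable_PiM_single')
    fix i
    show "(\<lambda>s. s i) \<in> measurable (path_borel t) (borel :: 'a measure)"
    proof (cases "i \<le> t")
      case True
      then show ?thesis unfolding path_borel_def by (intro measurable_component_singleton) simp
    next
      case False
      then have "s i = undefined" if "s \<in> space (path_borel t)" for s :: "nat \<Rightarrow> 'a"
        using that by (intro PiE_arb[of s "{..t}" "\<lambda>_. UNIV"]) (simp_all add: paths_def)
      then have "(\<lambda>s. s i) \<in> measurable (path_borel t) (borel :: 'a measure) \<longleftrightarrow>
          (\<lambda>s :: nat \<Rightarrow> 'a. undefined) \<in> measurable (path_borel t) (borel :: 'a measure)"
        by (rule measurable_cong)
      then show ?thesis by simp
    qed
  qed auto
  then show ?thesis using measurable_cong_sets[OF refl sets_PiM_equal_borel] by blast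
qed

lemma borel_measurable_path:
  assumes "f \<in> borel_measurable (borel :: (nat \<Rightarrow> 'a::euclidean_space) measure)"
  shows "f \<in> borel_measurable (path_borel t)"
  using measurable_compose[OF measurable_path_to_borel assms] .

lemma borel_measurable_restrict:
  assumes "f \<in> borel_measurable (path_borel t)"
  shows "(\<lambda>s :: nat \<Rightarrow> 'a::euclidean_space. f (restrict s {..t})) \<in> borel_measurable borel"
  using measurable_compose[OF measurable_restrict_borel assms] .

lemma continuous_on_psi1: "continuous_on A (psi1 :: 'a::real_normed_vector \<Rightarrow> real)"
  unfolding psi1_def by (intro continuous_intros)

lemma continuous_on_psi: "continuous_on A (psi T :: (nat \<Rightarrow> 'a::euclidean_space) \<Rightarrow> real)"
proof -
  have "continuous_on A (\<lambda>s :: nat \<Rightarrow> 'a. \<Sum>t\<le>T. 1 + norm (s t))"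
    by (intro continuous_intros continuous_on_subset[OF continuous_on_product_coordinates]) simp
  then show ?thesis by (simp add: psi_def[abs_def] psi1_def)
qed

lemma borel_measurable_psi [measurable]: "psi T \<in> borel_measurable borel"
  by (rule borel_measurable_continuous_onI[OF continuous_on_psi])

lemma borel_measurable_psi_path [measurable]: "psi T \<in> borel_measurable (path_borel t)"
  by (rule borel_measurable_path) measurable

lemma psi_restrict [simp]: "psi T (restrict s {..T}) = psi T s"
  by (simp add: psi_def)

lemma psi1_le_psi: "t \<le> T \<Longrightarrow> psi1 (s t) \<le> psi T s"
  unfolding psi_def by (rule member_le_sum) auto

lemma psi_ge_1: "1 \<le> psi T s"
  using psi1_le_psi[of 0 T s] psi1_ge_1[of "s 0"] by simp

lemma psi_pos [simp]: "0 < psi T s" using psi_ge_1[of T s] by simp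
lemma psi_nonneg [simp]: "0 \<le> psi T s" using psi_pos[of T s] by linarith
lemma psi_nonzero [simp]: "psi T s \<noteq> 0" using psi_pos[of T s] by linarith

lemma norm_increment_le_psi:
  assumes "t < T" shows "norm (s (Suc t) - s t) \<le> psi T s"
proof -
  have "norm (s (Suc t) - s t) \<le> psi1 (s (Suc t)) + psi1 (s t)"
    using norm_triangle_ineq4[of "s (Suc t)" "s t"] by (simp add: psi1_def)
  also have "\<dots> = (\<Sum>r\<in>{t, Suc t}. psi1 (s r))" by simp
  also have "\<dots> \<le> psi T s" unfolding psi_def using assms by (intro sum_mono2) auto
  finally show ?thesis .
qed

lemma gain_restrict [simp]: "gain T z (restrict s {..T}) = gain T z s"
  unfolding gain_def
proof (rule sum.cong[OF refl])
  fix t assume "t \<in> {..<T}"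
  then have "{..T} \<inter> {..t} = {..t}" "t \<le> T" "Suc t \<le> T" by auto
  then show "z t (restrict (restrict s {..T}) {..t}) \<bullet> (restrict s {..T} (Suc t) - restrict s {..T} t) =
      z t (restrict s {..t}) \<bullet> (s (Suc t) - s t)"
    by (simp add: restrict_restrict)
qed

lemma gain_bounded_by_psi:
  fixes z :: "nat \<Rightarrow> (nat \<Rightarrow> 'a::euclidean_space) \<Rightarrow> 'a"
  assumes "z \<in> trading_strategies T"
  obtains C where "\<And>s. \<bar>gain T z s\<bar> \<le> C * psi T s"
proof -
  have "\<exists>B. \<forall>p\<in>paths t. norm (z t p) \<le> B" if "t < T" for t
    using assms that by (auto simp: trading_strategies_def bounded_iff)
  then obtain B where B: "\<And>t p. t < T \<Longrightarrow> p \<in> paths t \<Longrightarrow> norm (z t p) \<le> B t" by metis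
  have "\<bar>gain T z s\<bar> \<le> (\<Sum>t<T. B t) * psi T s" for s
  proof -
    have "\<bar>gain T z s\<bar> \<le> (\<Sum>t<T. \<bar>z t (restrict s {..t}) \<bullet> (s (Suc t) - s t)\<bar>)"
      unfolding gain_def by (rule sum_abs)
    also have "\<dots> \<le> (\<Sum>t<T. B t * psi T s)"
    proof (rule sum_mono)
      fix t assume t: "t \<in> {..<T}"
      have "\<bar>z t (restrict s {..t}) \<bullet> (s (Suc t) - s t)\<bar> \<le>
          norm (z t (restrict s {..t})) * norm (s (Suc t) - s t)" by (rule Cauchy_Schwarz_ineq2)
      also have "\<dots> \<le> B t * psi T s"
      proof (rule mult_mono)
        show *: "norm (z t (restrict s {..t})) \<le> B t" using t by (intro B) auto
        show "0 \<le> B t" using norm_ge_zero * by (rule order_trans)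
      qed (use t in \<open>simp_all add: norm_increment_le_psi\<close>)
      finally show "\<bar>z t (restrict s {..t}) \<bullet> (s (Suc t) - s t)\<bar> \<le> B t * psi T s" .
    qed
    finally show ?thesis by (simp add: sum_distrib_right)
  qed
  then show ?thesis by (rule that)
qed

lemma measurable_path_component [measurable (raw)]:
  "t \<le> T \<Longrightarrow> (\<lambda>s. s t) \<in> measurable (path_borel T) (borel :: 'a::euclidean_space measure)"
  unfolding path_borel_def by (rule measurable_component_singleton) simp

lemma borel_measurable_gain:
  fixes z :: "nat \<Rightarrow> (nat \<Rightarrow> 'a::euclidean_space) \<Rightarrow> 'a"
  assumes z: "z \<in> trading_strategies T"
  shows "gain T z \<in> borel_measurable (path_borel T)"
  unfolding gain_def[abs_def]
proof (intro borel_measurable_sum borel_measurable_inner borel_measurable_diff)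
  fix t assume t: "t \<in> {..<T}"
  then have "z t \<in> borel_measurable (path_borel t)" using z by (simp add: trading_strategies_def)
  then show "(\<lambda>s. z t (restrict s {..t})) \<in> borel_measurable (path_borel T)"
    using t by (intro measurable_compose[OF measurable_restrict_path]) auto
qed (auto intro!: measurable_path_component)

lemma borel_measurable_usc:
  fixes u :: "(nat \<Rightarrow> 'a::euclidean_space) \<Rightarrow> real"
  assumes "usc_on_paths T u"
  shows "u \<in> borel_measurable (path_borel T)"
proof (rule borel_measurableI_less)
  fix a
  have "open {s. restrict s {..T} \<in> {s \<in> paths T. u s < a}}"
    using assms by (intro open_restrict_vimage) (simp add: usc_on_paths_def)
  then have "(\<lambda>s. s) -` {s. restrict s {..T} \<in> {s \<in> paths T. u s < a}} \<inter> space (path_borel T)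
      \<in> sets (path_borel T)"
    by (intro measurable_sets[OF measurable_path_to_borel]) simp
  also have "(\<lambda>s. s) -` {s. restrict s {..T} \<in> {s \<in> paths T. u s < a}} \<inter> space (path_borel T) =
      {s \<in> space (path_borel T). u s < a}" by auto
  finally show "{s \<in> space (path_borel T). u s < a} \<in> sets (path_borel T)" .
qed

text \<open>The product of a semicontinuous and a continuous positive function: the superlevel set is the
  union over \<open>q\<close> of the open sets \<open>{u < q} \<inter> {q < - a \<psi>}\<close>.\<close>

lemma lsc_rescaled:
  fixes u :: "(nat \<Rightarrow> 'a::euclidean_space) \<Rightarrow> real"
  assumes u: "usc_on_paths T u"
  shows "open {s. a < - u (restrict s {..T}) / psi T s}"
proof -
  have "{s. a < - u (restrict s {..T}) / psi T s} =
      (\<Union>q. {s. restrict s {..T} \<in> {s \<in> paths T. u s < q}} \<inter> {s. q + a * psi T s < 0})"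
  proof (rule set_eqI)
    fix s :: "nat \<Rightarrow> 'a"
    have "a < - u (restrict s {..T}) / psi T s \<longleftrightarrow> u (restrict s {..T}) < - a * psi T s"
      using pos_less_divide_eq[OF psi_pos[of T s], of a "- u (restrict s {..T})"] by auto
    also have "\<dots> \<longleftrightarrow> (\<exists>q. u (restrict s {..T}) < q \<and> q + a * psi T s < 0)"
    proof
      assume "u (restrict s {..T}) < - a * psi T s"
      then obtain q where "u (restrict s {..T}) < q" "q < - a * psi T s" using dense by blast
      then show "\<exists>q. u (restrict s {..T}) < q \<and> q + a * psi T s < 0" by (intro exI[of _ q]) auto
    qed auto
    finally show "s \<in> {s. a < - u (restrict s {..T}) / psi T s} \<longleftrightarrow>
        s \<in> (\<Union>q. {s. restrict s {..T} \<in> {s \<in> paths T. u s < q}} \<inter> {s. q + a * psi T s < 0})"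
      by simp
  qed
  also have "open \<dots>"
  proof (intro open_UN open_Int ballI)
    fix q
    show "open {s. restrict s {..T} \<in> {s \<in> paths T. u s < q}}"
      using u by (intro open_restrict_vimage) (simp add: usc_on_paths_def)
    show "open {s :: nat \<Rightarrow> 'a. q + a * psi T s < 0}"
      by (intro open_Collect_less continuous_intros continuous_on_psi)
  qed
  finally show ?thesis .
qed

lemma compact_PiE_cball:
  "compact (PiE {..T} (\<lambda>_. cball (0 :: 'a::euclidean_space) r))"
proof -
  define X where "X i = (if i \<le> T then cball (0 :: 'a) r else {undefined})" for i
  have "compactin (product_topology (\<lambda>_. euclidean) UNIV) (PiE UNIV X)"
    unfolding compactin_PiE by (simp add: X_def)
  then have "compact (PiE UNIV X)" by (simp add: euclidean_product_topology)
  also have "PiE UNIV X = PiE {..T} (\<lambda>_. cball 0 r)"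
    by (auto simp: X_def PiE_def Pi_def extensional_def split: if_splits)
  finally show ?thesis .
qed

section \<open>Weak duality\<close>

lemma nonneg_measuresD:
  assumes "\<mu> \<in> nonneg_measures T"
  shows "sets \<mu> = sets (path_borel T)" "finite_measure \<mu>" "integrable \<mu> (psi T)" "space \<mu> = paths T"
    "borel_measurable \<mu> = (borel_measurable (path_borel T) :: (_ \<Rightarrow> real) set)"
  using assms sets_eq_imp_space_eq[of \<mu> "path_borel T"] measurable_cong_sets[of \<mu> "path_borel T" borel borel]
  by (auto simp: nonneg_measures_def)

text \<open>Functions of growth at most \<open>\<psi>\<close> are integrable for every measure in \<open>M\<^sub>+\<close>.\<close>

lemma integrable_psi_bound:
  assumes \<mu>: "\<mu> \<in> nonneg_measures T" and f: "f \<in> borel_measurable (path_borel T)"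
    and b: "\<And>s. s \<in> paths T \<Longrightarrow> \<bar>f s\<bar> \<le> C * psi T s"
  shows "integrable \<mu> (f :: _ \<Rightarrow> real)"
proof (rule Bochner_Integration.integrable_bound)
  show "integrable \<mu> (\<lambda>s. C * psi T s)" using nonneg_measuresD(3)[OF \<mu>] by simp
  show "f \<in> borel_measurable \<mu>" using f nonneg_measuresD(5)[OF \<mu>] by simp
  show "AE s in \<mu>. norm (f s) \<le> norm (C * psi T s)"
  proof (rule AE_I2)
    fix s assume "s \<in> space \<mu>"
    then have "\<bar>f s\<bar> \<le> C * psi T s" using b nonneg_measuresD(4)[OF \<mu>] by blast
    also have "\<dots> \<le> \<bar>C * psi T s\<bar>" by simp
    finally show "norm (f s) \<le> norm (C * psi T s)" by simp
  qed
qed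

lemma measurable_component_nonneg_measures:
  fixes \<mu> :: "(nat \<Rightarrow> 'a::euclidean_space) measure"
  assumes "\<mu> \<in> nonneg_measures T" "t \<le> T"
  shows "(\<lambda>s. s t) \<in> measurable \<mu> borel"
  using measurable_path_component[OF assms(2), where 'a = 'a]
    measurable_cong_sets[OF nonneg_measuresD(1)[OF assms(1)] refl] by blast

lemma borel_measurable_lgfun [measurable]: "apply_lgfun x \<in> borel_measurable borel"
  by (rule borel_measurable_continuous_onI[OF continuous_apply_lgfun])

lemma borel_measurable_psi1 [measurable]: "psi1 \<in> borel_measurable borel"
  by (rule borel_measurable_continuous_onI[OF continuous_on_psi1])

lemma integrable_component:
  fixes \<mu> :: "(nat \<Rightarrow> 'a::euclidean_space) measure"
  assumes \<mu>: "\<mu> \<in> nonneg_measures T" and t: "t \<le> T"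
  shows "integrable \<mu> (\<lambda>s. psi1 (s t))" "integrable \<mu> (\<lambda>s. apply_lgfun x (s t))"
proof -
  show "integrable \<mu> (\<lambda>s. psi1 (s t))"
  proof (rule integrable_psi_bound[OF \<mu>, where C = 1])
    show "(\<lambda>s. psi1 (s t)) \<in> borel_measurable (path_borel T)"
      using t by (intro measurable_compose[OF measurable_path_component]) auto
  qed (use t psi1_le_psi in auto)
  show "integrable \<mu> (\<lambda>s. apply_lgfun x (s t))"
  proof (rule integrable_psi_bound[OF \<mu>, where C = "norm x"])
    show "(\<lambda>s. apply_lgfun x (s t)) \<in> borel_measurable (path_borel T)"
      using t by (intro measurable_compose[OF measurable_path_component]) auto
    show "\<bar>apply_lgfun x (s t)\<bar> \<le> norm x * psi T s" for s
      by (rule order_trans[OF abs_apply_lgfun_le mult_left_mono]) (use t psi1_le_psi in auto)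
  qed
qed

lemma marginal_facts:
  fixes \<mu> :: "(nat \<Rightarrow> 'a::euclidean_space) measure"
  assumes \<mu>: "\<mu> \<in> nonneg_measures T" and t: "t \<le> T"
  shows "sets (marginal \<mu> t) = sets borel" "integrable (marginal \<mu> t) psi1"
    "blinfun_apply (integral_functional (marginal \<mu> t)) x = (LINT s|\<mu>. apply_lgfun x (s t))"
proof -
  have m: "(\<lambda>s. s t) \<in> measurable \<mu> borel" by (rule measurable_component_nonneg_measures[OF assms])
  show 1: "sets (marginal \<mu> t) = sets borel" by (simp add: marginal_def)
  show 2: "integrable (marginal \<mu> t) psi1"
    unfolding marginal_def by (subst integrable_distr_eq[OF m]) (auto intro: integrable_component[OF assms])
  show "blinfun_apply (integral_functional (marginal \<mu> t)) x = (LINT s|\<mu>. apply_lgfun x (s t))"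
    unfolding integral_functional_apply[OF 1 2] unfolding marginal_def
    by (rule integral_distr[OF m]) simp
qed

lemma ext_integral_integrable:
  assumes "integrable M f"
  shows "ext_integral M f = ereal (LINT s|M. f s)"
proof -
  have fin: "(\<integral>\<^sup>+ s. ennreal (f s) \<partial>M) < \<infinity>" "(\<integral>\<^sup>+ s. ennreal (- f s) \<partial>M) < \<infinity>"
    using integrableD(2,3)[OF assms] by (auto simp: less_top)
  show ?thesis
    unfolding ext_integral_def real_lebesgue_integral_def[OF assms]
    using fin by (cases "\<integral>\<^sup>+ s. ennreal (f s) \<partial>M"; cases "\<integral>\<^sup>+ s. ennreal (- f s) \<partial>M")
      (auto simp: enn2ereal_ennreal)
qed

lemma ext_integral_mono:
  assumes "\<And>s. s \<in> space M \<Longrightarrow> f s \<le> g s"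
  shows "ext_integral M f \<le> ext_integral M g"
  unfolding ext_integral_def
proof (rule ereal_minus_mono)
  show "enn2ereal (\<integral>\<^sup>+ s. ennreal (f s) \<partial>M) \<le> enn2ereal (\<integral>\<^sup>+ s. ennreal (g s) \<partial>M)"
    unfolding less_eq_ennreal.rep_eq[symmetric] by (intro nn_integral_mono ennreal_leI assms)
  show "enn2ereal (\<integral>\<^sup>+ s. ennreal (- g s) \<partial>M) \<le> enn2ereal (\<integral>\<^sup>+ s. ennreal (- f s) \<partial>M)"
    unfolding less_eq_ennreal.rep_eq[symmetric] using assms by (intro nn_integral_mono ennreal_leI) auto
qed

lemma integrable_gain:
  assumes "\<mu> \<in> nonneg_measures T" "z \<in> trading_strategies T"
  shows "integrable \<mu> (gain T z)"
proof -
  obtain C where "\<And>s. \<bar>gain T z s\<bar> \<le> C * psi T s" by (rule gain_bounded_by_psi[OF assms(2)]) blast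
  then show ?thesis by (intro integrable_psi_bound[OF assms(1) borel_measurable_gain[OF assms(2)]])
qed

lemma conjugate_ge:
  assumes "G x = ereal g"
  shows "ereal (blinfun_apply \<phi> x - g) \<le> conjugate G \<phi>"
  unfolding conjugate_def using SUP_upper[of x UNIV "\<lambda>x. ereal (blinfun_apply \<phi> x) - G x"] assms by simp

lemma sum_ereal_finite_cases:
  fixes f :: "'i \<Rightarrow> ereal"
  assumes "finite I" "\<And>i. i \<in> I \<Longrightarrow> f i \<noteq> -\<infinity>" "(\<Sum>i\<in>I. f i) \<noteq> \<infinity>"
  obtains g where "\<And>i. i \<in> I \<Longrightarrow> f i = ereal (g i)" "(\<Sum>i\<in>I. f i) = ereal (\<Sum>i\<in>I. g i)"
proof -
  have "\<exists>r. f i = ereal r" if "i \<in> I" for i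
    using assms that by (cases "f i") (auto simp: sum_Pinfty)
  then obtain g where g: "\<And>i. i \<in> I \<Longrightarrow> f i = ereal (g i)" by metis
  then have "(\<Sum>i\<in>I. f i) = ereal (\<Sum>i\<in>I. g i)" by simp
  with g show ?thesis by (rule that)
qed

text \<open>Integrating the constraint of (A) against a martingale measure removes the gain; the rest is
  the Fenchel inequality at each time. The statement includes the infinite values.\<close>

theorem weak_duality:
  fixes G :: "nat \<Rightarrow> 'a::euclidean_space lgfun \<Rightarrow> ereal"
  assumes G: "\<And>t. t \<le> T \<Longrightarrow> proper_convex (G t)"
    and \<mu>: "\<mu> \<in> martingale_measures T"
  shows "- value_A T G u \<le> objective_B T G u \<mu>"
proof -
  have \<mu>': "\<mu> \<in> nonneg_measures T" using \<mu> by (simp add: martingale_measures_def)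
  have "- objective_B T G u \<mu> \<le> value_A T G u"
    unfolding value_A_def
  proof (rule Inf_greatest, clarify)
    fix x z assume z: "z \<in> trading_strategies T" and con: "constraint_A T u x z"
    show "- objective_B T G u \<mu> \<le> (\<Sum>t\<le>T. G t (x t))"
    proof (cases "(\<Sum>t\<le>T. G t (x t)) = \<infinity>")
      case False
      have "G t (x t) \<noteq> -\<infinity>" if "t \<in> {..T}" for t
        using G that by (simp add: proper_convex_def)
      then obtain g where g: "\<And>t. t \<in> {..T} \<Longrightarrow> G t (x t) = ereal (g t)"
        "(\<Sum>t\<le>T. G t (x t)) = ereal (\<Sum>t\<le>T. g t)"
        using sum_ereal_finite_cases[of "{..T}" "\<lambda>t. G t (x t)"] False by auto
      define I where "I t = (LINT s|\<mu>. apply_lgfun (x t) (s t))" for t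
      have int: "integrable \<mu> (gain T z)" "integrable \<mu> (\<lambda>s. \<Sum>t\<le>T. apply_lgfun (x t) (s t))"
        using integrable_gain[OF \<mu>' z] integrable_component(2)[OF \<mu>'] by auto
      have "ext_integral \<mu> u \<le> ext_integral \<mu> (\<lambda>s. gain T z s + (\<Sum>t\<le>T. apply_lgfun (x t) (s t)))"
        using con nonneg_measuresD(4)[OF \<mu>'] by (intro ext_integral_mono) (simp add: constraint_A_def)
      also have "\<dots> = ereal (LINT s|\<mu>. gain T z s + (\<Sum>t\<le>T. apply_lgfun (x t) (s t)))"
        using int by (intro ext_integral_integrable Bochner_Integration.integrable_add)
      also have "(LINT s|\<mu>. gain T z s + (\<Sum>t\<le>T. apply_lgfun (x t) (s t))) = (\<Sum>t\<le>T. I t)"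
      proof -
        have "(LINT s|\<mu>. gain T z s) = 0" using \<mu> z by (simp add: martingale_measures_def)
        then show ?thesis
          using int integrable_component(2)[OF \<mu>']
          by (simp add: I_def Bochner_Integration.integral_sum)
      qed
      finally have ext: "ext_integral \<mu> u \<le> ereal (\<Sum>t\<le>T. I t)" .
      have "ereal (\<Sum>t\<le>T. I t - g t) = (\<Sum>t\<le>T. ereal (I t - g t))" by simp
      also have "\<dots> \<le> (\<Sum>t\<le>T. conjugate (G t) (integral_functional (marginal \<mu> t)))"
      proof (rule sum_mono)
        fix t assume t: "t \<in> {..T}"
        then have "I t = blinfun_apply (integral_functional (marginal \<mu> t)) (x t)"
          using marginal_facts(3)[OF \<mu>', of t "x t"] by (simp add: I_def)
        then show "ereal (I t - g t) \<le> conjugate (G t) (integral_functional (marginal \<mu> t))"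
          using conjugate_ge[of "G t" "x t" "g t"] g(1)[OF t] by simp
      qed
      finally have "ereal (\<Sum>t\<le>T. I t - g t) - ereal (\<Sum>t\<le>T. I t) \<le> objective_B T G u \<mu>"
        unfolding objective_B_def using ext by (rule ereal_minus_mono)
      then have "ereal (- (\<Sum>t\<le>T. g t)) \<le> objective_B T G u \<mu>" by (simp add: sum_subtractf)
      then show ?thesis unfolding g(2) by (metis ereal_minus_le_minus ereal_uminus_uminus uminus_ereal.simps(1))
    qed simp
  qed
  then show ?thesis by (metis ereal_minus_le_minus ereal_uminus_uminus)
qed

section \<open>Positive functionals with tight marginals\<close>

text \<open>The function \<open>s \<mapsto> x (s\<^sub>t) / \<psi> s\<close>: a function of linear growth of the \<open>t\<close>-th coordinate, rescaled
  to a bounded continuous one.\<close>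

definition coord :: "nat \<Rightarrow> nat \<Rightarrow> 'a::euclidean_space lgfun \<Rightarrow> (nat \<Rightarrow> 'a) \<Rightarrow>\<^sub>C real" where
  "coord T t x = Bcontfun (\<lambda>s. apply_lgfun x (s t) / psi T s)"

lemma abs_lgfun_over_psi_le:
  assumes "t \<le> T"
  shows "\<bar>apply_lgfun x (s t) / psi T s\<bar> \<le> norm x"
proof -
  have "\<bar>apply_lgfun x (s t)\<bar> \<le> norm x * psi T s"
    by (rule order_trans[OF abs_apply_lgfun_le mult_left_mono]) (use assms psi1_le_psi in auto)
  then show ?thesis by (simp add: pos_divide_le_eq)
qed

lemma apply_coord:
  assumes "t \<le> T"
  shows "apply_bcontfun (coord T t x) s = apply_lgfun x (s t) / psi T s"
proof -
  have "continuous_on UNIV (\<lambda>s :: nat \<Rightarrow> 'a. apply_lgfun x (s t) / psi T s)"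
    by (intro continuous_intros continuous_on_psi continuous_on_compose2[OF continuous_apply_lgfun])
      auto
  then show ?thesis
    unfolding coord_def using abs_lgfun_over_psi_le[OF assms] by (subst apply_Bcontfun) auto
qed

text \<open>A continuous function of linear growth that vanishes on the ball of radius \<open>R\<close> and agrees with
  \<open>\<psi>\<^sub>t\<close> outside the ball of radius \<open>R + 1\<close>.\<close>

lift_definition tail :: "real \<Rightarrow> 'a::real_normed_vector lgfun" is
  "\<lambda>R s. psi1 s * min 1 (max 0 (norm s - R))"
proof
  fix R :: real
  show "continuous_on UNIV (\<lambda>s :: 'a. psi1 s * min 1 (max 0 (norm s - R)))"
    by (intro continuous_intros continuous_on_psi1)
  show "bounded (range (\<lambda>s :: 'a. psi1 s * min 1 (max 0 (norm s - R)) / psi1 s))"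
    by (rule boundedI[of _ 1]) auto
qed

lemma tail_nonneg: "0 \<le> apply_lgfun (tail R) s"
  and tail_le: "apply_lgfun (tail R) s \<le> psi1 s"
  and tail_inside: "norm s \<le> R \<Longrightarrow> apply_lgfun (tail R) s = 0"
  and tail_outside: "R + 1 \<le> norm s \<Longrightarrow> apply_lgfun (tail R) s = psi1 s"
  by (transfer; simp add: mult_le_cancel_left1)+

text \<open>Countable additivity in the form of tightness, by dominated convergence under the two parts
  of the Jordan decomposition.\<close>

lemma measure_functional_tail_tendsto_0:
  assumes "\<phi> \<in> measure_functionals"
  shows "(\<lambda>k. blinfun_apply \<phi> (tail (real k) :: 'a::euclidean_space lgfun)) \<longlonglongrightarrow> 0"
proof -
  obtain m where m: "signed_integrable borel m psi1"
    and \<phi>: "\<And>x. blinfun_apply \<phi> x = signed_integral borel m (apply_lgfun x)"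
    using assms by (auto simp: measure_functionals_def)
  have lim: "(\<lambda>k. LINT s|M. apply_lgfun (tail (real k)) s) \<longlonglongrightarrow> (LINT s|M. 0)"
    if M: "sets M = sets (borel :: 'a measure)" "integrable M (psi1 :: 'a \<Rightarrow> real)" for M
  proof (rule integral_dominated_convergence[OF _ _ M(2)])
    have "borel_measurable M = (borel_measurable borel :: ('a \<Rightarrow> real) set)"
      by (rule measurable_cong_sets[OF M(1) refl])
    then show "apply_lgfun (tail (real k)) \<in> borel_measurable M" for k by simp
    show "AE s in M. (\<lambda>k. apply_lgfun (tail (real k)) s) \<longlonglongrightarrow> 0"
    proof (rule AE_I2)
      fix s :: 'a
      obtain N where N: "norm s \<le> real N" using real_arch_simple by blast
      have "\<forall>\<^sub>F k in sequentially. apply_lgfun (tail (real k)) s = 0"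
        using N by (intro eventually_sequentiallyI[of N] tail_inside) simp
      then show "(\<lambda>k. apply_lgfun (tail (real k)) s) \<longlonglongrightarrow> 0" by (rule tendsto_eventually)
    qed
    show "AE s in M. norm (apply_lgfun (tail (real k)) s) \<le> psi1 s" for k
    proof (rule AE_I2)
      fix s :: 'a
      show "norm (apply_lgfun (tail (real k)) s) \<le> psi1 s"
        using tail_nonneg[of "real k" s] tail_le[of "real k" s] by simp
    qed
  qed simp
  have "(\<lambda>k. (LINT s|pos_variation borel m. apply_lgfun (tail (real k)) s) -
      (LINT s|neg_variation borel m. apply_lgfun (tail (real k)) s)) \<longlonglongrightarrow>
      (LINT s|pos_variation borel m. 0 :: real) - (LINT s|neg_variation borel m. 0)"
    using m by (intro tendsto_diff lim) (auto simp: signed_integrable_def neg_variation_def)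
  then show ?thesis by (simp add: \<phi> signed_integral_def)
qed

text \<open>If some coordinate lies far out, then so does the coordinate of largest norm, which dominates
  all terms of \<open>\<psi>\<close>.\<close>

lemma psi_le_sum_tail:
  fixes s :: "nat \<Rightarrow> 'a::euclidean_space"
  assumes "t \<le> T" "R + 1 \<le> norm (s t)"
  shows "psi T s \<le> (real T + 1) * (\<Sum>r\<le>T. apply_lgfun (tail R) (s r))"
proof -
  have "Max ((\<lambda>r. norm (s r)) ` {..T}) \<in> (\<lambda>r. norm (s r)) ` {..T}" by (rule Max_in) auto
  then obtain m where m: "Max ((\<lambda>r. norm (s r)) ` {..T}) = norm (s m)" "m \<in> {..T}" by (rule imageE)
  have max: "norm (s r) \<le> norm (s m)" if "r \<le> T" for r
    unfolding m(1)[symmetric] using that by (intro Max_ge) auto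
  have "psi T s \<le> (\<Sum>r\<le>T. psi1 (s m))"
    unfolding psi_def by (rule sum_mono) (simp add: psi1_def max)
  also have "\<dots> = (real T + 1) * psi1 (s m)" by simp
  also have "psi1 (s m) = apply_lgfun (tail R) (s m)"
    using max[OF assms(1)] assms(2) by (intro tail_outside[symmetric]) simp
  also have "(real T + 1) * apply_lgfun (tail R) (s m) \<le> (real T + 1) * (\<Sum>r\<le>T. apply_lgfun (tail R) (s r))"
    using m(2) by (intro mult_left_mono member_le_sum) (auto simp: tail_nonneg)
  finally show ?thesis .
qed

lemma dini_bcontfun:
  fixes F :: "nat \<Rightarrow> 'b::metric_space \<Rightarrow>\<^sub>C real"
  assumes K: "compact K" and dec: "\<And>n x. F (Suc n) x \<le> F n x"
    and lim: "\<And>x. (\<lambda>n. F n x) \<longlonglongrightarrow> 0" and "\<delta> > 0"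
  obtains N where "\<And>n x. n \<ge> N \<Longrightarrow> x \<in> K \<Longrightarrow> F n x < \<delta>"
proof -
  have dec': "F n x \<le> F m x" if "m \<le> n" for m n x
    using lift_Suc_antimono_le[of "\<lambda>n. F n x" m n] dec that by blast
  have "open {x. F n x < \<delta>}" for n by (intro open_Collect_less continuous_intros) 
  moreover have "K \<subseteq> (\<Union>n. {x. F n x < \<delta>})"
  proof
    fix x
    have "\<forall>\<^sub>F n in sequentially. F n x < \<delta>" using lim[of x] \<open>\<delta> > 0\<close> by (rule order_tendstoD)
    then show "x \<in> (\<Union>n. {x. F n x < \<delta>})" by (auto simp: eventually_sequentially)
  qed
  ultimately obtain C where C: "finite C" "K \<subseteq> (\<Union>n\<in>C. {x. F n x < \<delta>})"
    using compactE_image[OF K, of UNIV "\<lambda>n. {x. F n x < \<delta>}"] by auto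
  show ?thesis
  proof (rule that)
    fix n x assume n: "n \<ge> Max (insert 0 C)" and "x \<in> K"
    then obtain m where m: "m \<in> C" "F m x < \<delta>" using C by blast
    have "m \<le> n" using n m C(1) by simp
    then show "F n x < \<delta>" using dec'[of m n x] m(2) by simp
  qed
qed

text \<open>A positive functional whose marginals are measures satisfies the continuity required of a
  Daniell integral. Positivity is assumed relative to \<open>paths T\<close>, so the coordinates after \<open>T\<close> do not
  matter. A sequence decreasing to \<open>0\<close> is uniformly small on a compact box by Dini's theorem, and
  outside the box it is dominated by the tails of the marginals.\<close>

lemma daniell_functionalI_tight:
  fixes L :: "((nat \<Rightarrow> 'a::euclidean_space) \<Rightarrow>\<^sub>C real) \<Rightarrow> real"
  assumes lin: "linear L"
    and pos: "\<And>w. (\<And>s. s \<in> paths T \<Longrightarrow> 0 \<le> apply_bcontfun w s) \<Longrightarrow> 0 \<le> L w"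
    and marg: "\<And>t x. t \<le> T \<Longrightarrow> blinfun_apply (\<phi> t) x = L (coord T t x)"
    and meas: "\<And>t. t \<le> T \<Longrightarrow> \<phi> t \<in> measure_functionals"
  shows "daniell_functional L"
proof (rule daniell_functional.intro)
  show "linear L" by fact
  show "0 \<le> L f" if "\<And>x. 0 \<le> apply_bcontfun f x" for f using that by (rule pos)
  fix F :: "nat \<Rightarrow> (nat \<Rightarrow> 'a) \<Rightarrow>\<^sub>C real"
  assume dec: "\<And>n x. F (Suc n) x \<le> F n x" and lim: "\<And>x. (\<lambda>n. F n x) \<longlonglongrightarrow> 0"
  note L_simps = linear_add[OF lin] linear_diff[OF lin] linear_sum[OF lin] linear_scale[OF lin]
  have dec': "F n x \<le> F m x" if "m \<le> n" for m n x
    using lift_Suc_antimono_le[of "\<lambda>n. F n x" m n] dec that by blast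
  have Fpos: "0 \<le> F n x" for n x
    using lim[of x] dec' by (intro LIMSEQ_le_const2[of "\<lambda>n. F n x"]) auto
  define D where "D = norm (F 0) * (real T + 1)"
  show "(\<lambda>n. L (F n)) \<longlonglongrightarrow> 0"
  proof (rule LIMSEQ_I)
    fix e :: real assume e: "0 < e"
    have "(\<lambda>k. D * (\<Sum>t\<le>T. blinfun_apply (\<phi> t) (tail (real k)))) \<longlonglongrightarrow> D * (\<Sum>t\<le>T. 0)"
      by (intro tendsto_intros measure_functional_tail_tendsto_0 meas) simp
    then have "\<forall>\<^sub>F k in sequentially. D * (\<Sum>t\<le>T. blinfun_apply (\<phi> t) (tail (real k))) < e / 2"
      using e by (intro order_tendstoD(2)) auto
    then obtain k where k: "D * (\<Sum>t\<le>T. blinfun_apply (\<phi> t) (tail (real k))) < e / 2"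
      by (auto simp: eventually_sequentially)
    have L1: "0 \<le> L (const_bcontfun 1)" by (rule pos) simp
    define \<delta> where "\<delta> = e / (2 * (L (const_bcontfun 1) + 1))"
    have \<delta>: "\<delta> > 0" "\<delta> * L (const_bcontfun 1) \<le> e / 2"
      using e L1 by (auto simp: \<delta>_def field_simps)
    obtain N where N: "\<And>n s. n \<ge> N \<Longrightarrow> s \<in> PiE {..T} (\<lambda>_. cball 0 (real k + 1)) \<Longrightarrow> F n s < \<delta>"
      using dini_bcontfun[OF compact_PiE_cball dec lim \<delta>(1)] by blast
    have "L (F n) < e" if n: "n \<ge> N" for n
    proof -
      \<comment> \<open>\<open>w \<ge> 0\<close> on the paths: inside the box the first term dominates \<open>F n\<close>, outside the second
        one does.\<close>
      define w where "w = \<delta> *\<^sub>R const_bcontfun 1 + D *\<^sub>R (\<Sum>t\<le>T. coord T t (tail (real k))) - F n"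
      have "0 \<le> L w"
      proof (rule pos)
        fix s :: "nat \<Rightarrow> 'a" assume s: "s \<in> paths T"
        define q where "q = (\<Sum>t\<le>T. apply_lgfun (tail (real k)) (s t)) / psi T s"
        have q0: "0 \<le> q" unfolding q_def by (intro divide_nonneg_pos sum_nonneg tail_nonneg) simp
        have ws: "w s = \<delta> + D * q - F n s"
          by (simp add: w_def sum_apply_bcontfun apply_coord q_def sum_divide_distrib)
        have D0: "0 \<le> D" by (simp add: D_def)
        have "F n s \<le> \<delta> + D * q"
        proof (cases "s \<in> PiE {..T} (\<lambda>_. cball 0 (real k + 1))")
          case True
          then show ?thesis using N[OF n True] mult_nonneg_nonneg[OF D0 q0] by simp
        next
          case False
          then obtain t where t: "t \<le> T" "real k + 1 \<le> norm (s t)"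
            using s by (force simp: paths_def PiE_def)
          have "psi T s \<le> (real T + 1) * (\<Sum>r\<le>T. apply_lgfun (tail (real k)) (s r))"
            by (rule psi_le_sum_tail[of t]) (use t in auto)
          then have "1 \<le> (real T + 1) * q" by (simp add: q_def pos_le_divide_eq)
          then have "norm (F 0) * 1 \<le> norm (F 0) * ((real T + 1) * q)" by (rule mult_left_mono) simp
          moreover have "F n s \<le> norm (F 0)"
            using dec'[of 0 n s] norm_bounded[of "F 0" s] by simp
          ultimately show ?thesis using \<delta>(1) by (simp add: D_def mult.assoc)
        qed
        then show "0 \<le> w s" by (simp add: ws)
      qed
      also have "L w = \<delta> * L (const_bcontfun 1) + D * (\<Sum>t\<le>T. blinfun_apply (\<phi> t) (tail (real k))) - L (F n)"
        by (simp add: w_def L_simps marg)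
      finally show ?thesis using k \<delta>(2) by simp
    qed
    moreover have "0 \<le> L (F n)" for n by (rule pos) (rule Fpos)
    ultimately show "\<exists>N. \<forall>n\<ge>N. norm (L (F n) - 0) < e" by (intro exI[of _ N]) auto
  qed
qed

text \<open>The measure with density \<open>1 / \<psi>\<close> with respect to \<open>\<nu>\<close>, transported to \<open>paths T\<close>. It undoes the
  rescaling by \<open>\<psi>\<close> that makes functions of linear growth bounded.\<close>

definition path_measure :: "nat \<Rightarrow> (nat \<Rightarrow> 'a::euclidean_space) measure \<Rightarrow> (nat \<Rightarrow> 'a) measure" where
  "path_measure T \<nu> = distr (density \<nu> (\<lambda>s. ennreal (1 / psi T s))) (path_borel T) (\<lambda>s. restrict s {..T})"

lemma path_measure_integral:
  fixes f :: "(nat \<Rightarrow> 'a::euclidean_space) \<Rightarrow> real"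
  assumes \<nu>: "sets \<nu> = sets borel" and f: "f \<in> borel_measurable (path_borel T)"
  shows "integrable (path_measure T \<nu>) f \<longleftrightarrow> integrable \<nu> (\<lambda>s. f (restrict s {..T}) / psi T s)"
    and "(LINT s|path_measure T \<nu>. f s) = (LINT s|\<nu>. f (restrict s {..T}) / psi T s)"
proof -
  have "(\<lambda>s. restrict s {..T}) \<in> measurable \<nu> (path_borel T)"
    unfolding measurable_cong_sets[OF \<nu> refl] by (rule measurable_restrict_borel)
  then have m: "(\<lambda>s. restrict s {..T}) \<in> measurable (density \<nu> (\<lambda>s. ennreal (1 / psi T s))) (path_borel T)"
    by simp
  have mf: "(\<lambda>s. f (restrict s {..T})) \<in> borel_measurable \<nu>" "(\<lambda>s. 1 / psi T s) \<in> borel_measurable \<nu>"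
    unfolding measurable_cong_sets[OF \<nu> refl] by (rule borel_measurable_restrict[OF f]) measurable
  show "integrable (path_measure T \<nu>) f \<longleftrightarrow> integrable \<nu> (\<lambda>s. f (restrict s {..T}) / psi T s)"
    unfolding path_measure_def integrable_distr_eq[OF m f]
    by (subst integrable_real_density[OF mf(2) _ mf(1)]) simp_all
  show "(LINT s|path_measure T \<nu>. f s) = (LINT s|\<nu>. f (restrict s {..T}) / psi T s)"
    unfolding path_measure_def integral_distr[OF m f]
    by (subst integral_real_density[OF mf(2) _ mf(1)]) simp_all
qed

lemma path_measure_nonneg:
  fixes \<nu> :: "(nat \<Rightarrow> 'a::euclidean_space) measure"
  assumes \<nu>: "sets \<nu> = sets borel" "finite_measure \<nu>"
  shows "path_measure T \<nu> \<in> nonneg_measures T"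
proof -
  interpret finite_measure \<nu> by fact
  have sp: "space (path_measure T \<nu>) = paths T" by (simp add: path_measure_def)
  have s: "sets (path_measure T \<nu>) = sets (path_borel T)" by (simp add: path_measure_def)
  have psi: "integrable (path_measure T \<nu>) (psi T)"
    by (subst path_measure_integral(1)[OF \<nu>(1)]) auto
  have "integrable (path_measure T \<nu>) (indicator (paths T) :: _ \<Rightarrow> real)"
  proof (rule Bochner_Integration.integrable_bound[OF psi])
    have "paths T \<in> sets (path_measure T \<nu>)" using sets.top[of "path_measure T \<nu>"] by (simp add: sp)
    then show "indicator (paths T) \<in> borel_measurable (path_measure T \<nu>)" by simp
    show "AE x in path_measure T \<nu>. norm (indicator (paths T) x :: real) \<le> norm (psi T x)"
    proof (rule AE_I2)
      fix x :: "nat \<Rightarrow> 'a"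
      show "norm (indicator (paths T) x :: real) \<le> norm (psi T x)"
        using psi_ge_1[of T x] by (simp add: indicator_def)
    qed
  qed
  then have "finite_measure (path_measure T \<nu>)" 
    by (intro finite_measureI) (simp add: integrable_indicator_iff sp less_top)
  then show ?thesis using psi s by (simp add: nonneg_measures_def)
qed

section \<open>Martingale measures and sums of conjugates\<close>

text \<open>The strategy that trades at the single time \<open>t\<close> only, holding \<open>c f\<close> units in the direction \<open>e\<close>
  for a bounded continuous \<open>f\<close> of the path up to \<open>t\<close>.\<close>

definition hold :: "nat \<Rightarrow> ((nat \<Rightarrow> 'a::euclidean_space) \<Rightarrow>\<^sub>C real) \<Rightarrow> 'a \<Rightarrow> real \<Rightarrow> nat \<Rightarrow> (nat \<Rightarrow> 'a) \<Rightarrow> 'a" where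
  "hold t f e c = (\<lambda>r p. if r = t then (c * apply_bcontfun f p) *\<^sub>R e else 0)"

lemma hold_trading: "hold t f e c \<in> trading_strategies T"
  unfolding trading_strategies_def
proof (intro CollectI allI impI conjI)
  fix r
  have "apply_bcontfun f \<in> borel_measurable (path_borel r)"
    by (rule borel_measurable_path[OF measurable_apply_bcontfun])
  then show "hold t f e c r \<in> borel_measurable (path_borel r)"
    unfolding hold_def by (cases "r = t") simp_all
  show "bounded (hold t f e c r ` paths r)"
    unfolding bounded_iff
  proof (intro exI ballI)
    fix y assume "y \<in> hold t f e c r ` paths r"
    then show "norm y \<le> (\<bar>c\<bar> * norm f) * norm e"
      using norm_bounded[of f] by (auto simp: hold_def abs_mult intro!: mult_right_mono mult_left_mono)
  qed
qed

lemma gain_hold: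
  assumes "t < T"
  shows "gain T (hold t f e c) s = c * (f (restrict s {..t}) * ((s (Suc t) - s t) \<bullet> e))"
proof -
  have "gain T (hold t f e c) s =
      (\<Sum>r<T. if r = t then c * (f (restrict s {..t}) * ((s (Suc t) - s t) \<bullet> e)) else 0)"
    unfolding gain_def by (rule sum.cong) (auto simp: hold_def inner_commute)
  then show ?thesis using assms by simp
qed

text \<open>The gain of such a strategy, rescaled by \<open>\<psi>\<close> to a bounded continuous function.\<close>

definition gain_bcont :: "nat \<Rightarrow> nat \<Rightarrow> ((nat \<Rightarrow> 'a::euclidean_space) \<Rightarrow>\<^sub>C real) \<Rightarrow> 'a \<Rightarrow> (nat \<Rightarrow> 'a) \<Rightarrow>\<^sub>C real" where
  "gain_bcont T t f e = Bcontfun (\<lambda>s. gain T (hold t f e 1) s / psi T s)"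

lemma apply_gain_bcont:
  assumes t: "t < T"
  shows "apply_bcontfun (gain_bcont T t f e) s = gain T (hold t f e 1) s / psi T s"
proof -
  have g: "gain T (hold t f e 1) s = f (restrict s {..t}) * ((s (Suc t) - s t) \<bullet> e)" for s
    using gain_hold[OF t, of f e 1] by simp
  have "continuous_on UNIV (\<lambda>s :: nat \<Rightarrow> 'a. gain T (hold t f e 1) s / psi T s)"
    unfolding g
    by (intro continuous_on_divide continuous_on_mult continuous_on_inner continuous_on_diff
        continuous_on_apply_bcontfun_comp continuous_on_restrict_UNIV continuous_on_product_coordinates
        continuous_on_const continuous_on_psi) simp
  moreover have "\<bar>gain T (hold t f e 1) s / psi T s\<bar> \<le> norm f * norm e" for s
  proof -
    have "\<bar>gain T (hold t f e 1) s\<bar> \<le> norm f * (norm (s (Suc t) - s t) * norm e)"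
      unfolding g abs_mult
      using norm_bounded[of f] Cauchy_Schwarz_ineq2 by (intro mult_mono) auto
    also have "\<dots> \<le> norm f * (psi T s * norm e)"
      using t by (intro mult_left_mono mult_right_mono norm_increment_le_psi) auto
    finally show ?thesis by (simp add: pos_divide_le_eq mult_ac)
  qed
  ultimately show ?thesis unfolding gain_bcont_def by (subst apply_Bcontfun) auto
qed

lemma trading_strategies_comb:
  assumes "z1 \<in> trading_strategies T" "z2 \<in> trading_strategies T"
  shows "(\<lambda>t p. a *\<^sub>R z1 t p + b *\<^sub>R z2 t p) \<in> trading_strategies T"
  using assms unfolding trading_strategies_def
  by (auto intro!: borel_measurable_add borel_measurable_scaleR bounded_plus_comp bounded_scaleR_comp)

lemma gain_comb:
  "gain T (\<lambda>t p. a *\<^sub>R z1 t p + b *\<^sub>R z2 t p) s = a * gain T z1 s + b * gain T z2 s"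
  by (simp add: gain_def inner_add_left sum.distrib sum_distrib_left)

text \<open>It suffices to test the martingale property with bounded continuous strategies at a single time
  in a coordinate direction: the positive and the negative part of the increment define two finite
  measures on the paths up to \<open>t\<close>, and these agree if they agree on bounded continuous functions.\<close>

lemma martingale_measuresI:
  fixes \<mu> :: "(nat \<Rightarrow> 'a::euclidean_space) measure"
  assumes \<mu>: "\<mu> \<in> nonneg_measures T"
    and mart: "\<And>t f e. t < T \<Longrightarrow> e \<in> Basis \<Longrightarrow> (LINT s|\<mu>. gain T (hold t f e 1) s) = 0"
  shows "\<mu> \<in> martingale_measures T"
proof -
  have key: "integrable \<mu> (\<lambda>s. g (restrict s {..t}) * ((s (Suc t) - s t) \<bullet> e)) \<and>
      (LINT s|\<mu>. g (restrict s {..t}) * ((s (Suc t) - s t) \<bullet> e)) = 0"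
    if t: "t < T" and e: "e \<in> Basis" and g: "g \<in> borel_measurable (path_borel t)"
      and B: "\<And>p. p \<in> paths t \<Longrightarrow> \<bar>g p\<bar> \<le> B" for t e B and g :: "(nat \<Rightarrow> 'a) \<Rightarrow> real"
  proof -
    define D where "D s = (s (Suc t) - s t) \<bullet> e" for s :: "nat \<Rightarrow> 'a"
    have Dm: "D \<in> borel_measurable (path_borel T)"
      unfolding D_def using t by (intro borel_measurable_inner borel_measurable_diff measurable_path_component) auto
    have Db: "\<bar>D s\<bar> \<le> 1 * psi T s" for s
      using Cauchy_Schwarz_ineq2[of "s (Suc t) - s t" e] norm_increment_le_psi[OF t, of s] e
      by (simp add: D_def)
    have Dint: "integrable \<mu> D" by (rule integrable_psi_bound[OF \<mu> Dm Db])
    \<comment> \<open>\<open>\<sigma> = 1\<close> gives the positive and \<open>\<sigma> = -1\<close> the negative part of \<open>D\<close>.\<close>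
    define N where "N \<sigma> = distr (density \<mu> (\<lambda>s. ennreal (max 0 (\<sigma> * D s)))) borel (\<lambda>s. restrict s {..t})" for \<sigma>
    have rm: "(\<lambda>s. restrict s {..t}) \<in> measurable \<mu> (borel :: (nat \<Rightarrow> 'a) measure)"
    proof -
      have "(\<lambda>s. restrict s {..t}) \<in> measurable (path_borel T) (path_borel t :: (nat \<Rightarrow> 'a) measure)"
        using t by (intro measurable_restrict_path) simp
      from measurable_compose[OF this measurable_path_to_borel]
      show ?thesis unfolding measurable_cong_sets[OF nonneg_measuresD(1)[OF \<mu>] refl] .
    qed
    have Dm': "(\<lambda>s. max 0 (\<sigma> * D s)) \<in> borel_measurable \<mu>" for \<sigma>
      using Dint by (intro borel_measurable_max borel_measurable_times) auto
    have part: "integrable \<mu> (\<lambda>s. max 0 (\<sigma> * D s))" for \<sigma>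
      using Dint by (intro integrable_max) auto
    have intN: "(LINT p|N \<sigma>. h p) = (LINT s|\<mu>. max 0 (\<sigma> * D s) * h (restrict s {..t}))"
      if h: "h \<in> borel_measurable borel" for h :: "(nat \<Rightarrow> 'a) \<Rightarrow> real" and \<sigma>
    proof -
      have "(LINT p|N \<sigma>. h p) = (LINT s|density \<mu> (\<lambda>s. ennreal (max 0 (\<sigma> * D s))). h (restrict s {..t}))"
        unfolding N_def using rm by (intro integral_distr h) simp
      also have "\<dots> = (LINT s|\<mu>. max 0 (\<sigma> * D s) * h (restrict s {..t}))"
        by (intro integral_real_density Dm' measurable_compose[OF rm h]) simp
      finally show ?thesis .
    qed
    have intp: "integrable \<mu> (\<lambda>s. max 0 (\<sigma> * D s) * h (restrict s {..t}))"
      if h: "h \<in> borel_measurable borel" and b: "\<And>s. \<bar>h (restrict s {..t})\<bar> \<le> b"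
      for h :: "(nat \<Rightarrow> 'a) \<Rightarrow> real" and b \<sigma>
    proof (rule Bochner_Integration.integrable_bound)
      show "integrable \<mu> (\<lambda>s. b * max 0 (\<sigma> * D s))" using part by simp
      show "(\<lambda>s. max 0 (\<sigma> * D s) * h (restrict s {..t})) \<in> borel_measurable \<mu>"
        by (intro borel_measurable_times Dm' measurable_compose[OF rm h])
      show "AE s in \<mu>. norm (max 0 (\<sigma> * D s) * h (restrict s {..t})) \<le> norm (b * max 0 (\<sigma> * D s))"
      proof (rule AE_I2)
        fix s
        have "\<bar>h (restrict s {..t})\<bar> \<le> \<bar>b\<bar>" using b[of s] by linarith
        then show "norm (max 0 (\<sigma> * D s) * h (restrict s {..t})) \<le> norm (b * max 0 (\<sigma> * D s))"
          unfolding real_norm_def abs_mult mult.commute[of "\<bar>b\<bar>"] by (rule mult_left_mono) simp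
      qed
    qed
    have diff: "(LINT s|\<mu>. D s * h (restrict s {..t})) = (LINT p|N 1. h p) - (LINT p|N (-1). h p)"
      "integrable \<mu> (\<lambda>s. D s * h (restrict s {..t}))"
      if h: "h \<in> borel_measurable borel" and b: "\<And>s. \<bar>h (restrict s {..t})\<bar> \<le> b"
      for h :: "(nat \<Rightarrow> 'a) \<Rightarrow> real" and b
    proof -
      have eq: "D s * h (restrict s {..t}) =
          max 0 (1 * D s) * h (restrict s {..t}) - max 0 (-1 * D s) * h (restrict s {..t})" for s
        by (simp add: max_def)
      show "(LINT s|\<mu>. D s * h (restrict s {..t})) = (LINT p|N 1. h p) - (LINT p|N (-1). h p)"
        unfolding intN[OF h] eq by (rule Bochner_Integration.integral_diff) (rule intp[OF h b])+
      show "integrable \<mu> (\<lambda>s. D s * h (restrict s {..t}))"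
        unfolding eq by (rule Bochner_Integration.integrable_diff) (rule intp[OF h b])+
    qed
    have finN: "finite_measure (N \<sigma>)" for \<sigma>
    proof (rule finite_measureI)
      have "emeasure (N \<sigma>) (space (N \<sigma>)) = (\<integral>\<^sup>+ s. ennreal (max 0 (\<sigma> * D s)) \<partial>\<mu>)"
      proof -
        have "emeasure (N \<sigma>) (space (N \<sigma>)) = emeasure (density \<mu> (\<lambda>s. ennreal (max 0 (\<sigma> * D s)))) (space \<mu>)"
          unfolding N_def using rm by (subst emeasure_distr) simp_all
        also have "\<dots> = (\<integral>\<^sup>+ s. ennreal (max 0 (\<sigma> * D s)) * indicator (space \<mu>) s \<partial>\<mu>)"
          using Dm' by (intro emeasure_density) auto
        also have "\<dots> = (\<integral>\<^sup>+ s. ennreal (max 0 (\<sigma> * D s)) \<partial>\<mu>)"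
          by (intro nn_integral_cong) simp
        finally show ?thesis .
      qed
      also have "\<dots> = ennreal (LINT s|\<mu>. max 0 (\<sigma> * D s))"
        using part by (intro nn_integral_eq_integral) auto
      finally show "emeasure (N \<sigma>) (space (N \<sigma>)) \<noteq> \<infinity>" by simp
    qed
    have "N 1 = N (-1)"
    proof (rule measure_eqI_bcontfun)
      fix f :: "(nat \<Rightarrow> 'a) \<Rightarrow>\<^sub>C real"
      have "(LINT s|\<mu>. D s * f (restrict s {..t})) = 0"
        using mart[OF t e, of f] by (simp add: gain_hold[OF t] D_def mult.commute)
      then show "(LINT p|N 1. f p) = (LINT p|N (-1). f p)"
        using diff(1)[of "apply_bcontfun f" "norm f"] norm_bounded[of f] by simp
    qed (auto simp: finN, auto simp: N_def)
    note N_eq = this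
    define h where "h p = g (restrict p {..t})" for p
    have h: "h \<in> borel_measurable borel" unfolding h_def by (rule borel_measurable_restrict[OF g])
    have hr: "h (restrict s {..t}) = g (restrict s {..t})" for s by (simp add: h_def)
    have hb: "\<bar>h (restrict s {..t})\<bar> \<le> B" for s unfolding hr by (rule B) simp
    have eq: "(\<lambda>s. D s * h (restrict s {..t})) = (\<lambda>s. g (restrict s {..t}) * ((s (Suc t) - s t) \<bullet> e))"
      by (rule ext) (simp only: hr D_def mult.commute)
    show ?thesis
      using diff[OF h hb] unfolding N_eq eq by simp
  qed
  have "(LINT s|\<mu>. gain T z s) = 0" if z: "z \<in> trading_strategies T" for z
  proof -
    have K: "integrable \<mu> (\<lambda>s. (z t (restrict s {..t}) \<bullet> e) * ((s (Suc t) - s t) \<bullet> e)) \<and>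
        (LINT s|\<mu>. (z t (restrict s {..t}) \<bullet> e) * ((s (Suc t) - s t) \<bullet> e)) = 0"
      if t: "t < T" and e: "e \<in> Basis" for t e
    proof -
      have zt: "z t \<in> borel_measurable (path_borel t)" "bounded (z t ` paths t)"
        using z t by (auto simp: trading_strategies_def)
      then obtain B where B: "\<And>p. p \<in> paths t \<Longrightarrow> norm (z t p) \<le> B" by (auto simp: bounded_iff)
      show ?thesis
      proof (rule key[OF t e, of "\<lambda>p. z t p \<bullet> e" B])
        show "(\<lambda>p. z t p \<bullet> e) \<in> borel_measurable (path_borel t)" using zt by simp
        show "\<bar>z t p \<bullet> e\<bar> \<le> B" if "p \<in> paths t" for p
          using Basis_le_norm[OF e, of "z t p"] B[OF that] by linarith
      qed
    qed
    have "gain T z s = (\<Sum>t<T. \<Sum>e\<in>Basis. (z t (restrict s {..t}) \<bullet> e) * ((s (Suc t) - s t) \<bullet> e))" for s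
      unfolding gain_def by (intro sum.cong refl euclidean_inner)
    then have "(LINT s|\<mu>. gain T z s) =
        (\<Sum>t<T. \<Sum>e\<in>Basis. LINT s|\<mu>. (z t (restrict s {..t}) \<bullet> e) * ((s (Suc t) - s t) \<bullet> e))"
      using K by (simp add: Bochner_Integration.integral_sum)
    also have "\<dots> = 0" using K by (intro sum.neutral ballI) auto
    finally show ?thesis .
  qed
  then show ?thesis using \<mu> by (simp add: martingale_measures_def)
qed

lemma conjugate_not_MInf:
  assumes "proper_convex G" shows "conjugate G \<phi> \<noteq> -\<infinity>"
proof -
  obtain x where x: "G x \<noteq> \<infinity>" "G x \<noteq> -\<infinity>" using assms by (auto simp: proper_convex_def)
  then obtain g where "G x = ereal g" by (cases "G x") auto
  from conjugate_ge[where G = G, OF this, of \<phi>] show ?thesis by auto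
qed

text \<open>The supremum of a separable function is the sum of the suprema, by induction on the number
  of terms.\<close>

lemma conjugate_sum_le:
  assumes "finite I" and "\<And>i. i \<in> I \<Longrightarrow> proper_convex (G i)"
    and "\<And>x g. (\<And>i. i \<in> I \<Longrightarrow> G i (x i) = ereal (g i)) \<Longrightarrow>
      (\<Sum>i\<in>I. blinfun_apply (\<phi> i) (x i) - g i) \<le> B"
  shows "(\<Sum>i\<in>I. conjugate (G i) (\<phi> i)) \<le> ereal B"
  using assms
proof (induction I arbitrary: B rule: finite_induct)
  case empty
  then show ?case by (simp add: zero_ereal_def)
next
  case (insert i I)
  have step: "(\<Sum>j\<in>I. conjugate (G j) (\<phi> j)) \<le> ereal (B - (blinfun_apply (\<phi> i) y - h))"
    if y: "G i y = ereal h" for y h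
  proof (rule insert.IH)
    show "proper_convex (G j)" if "j \<in> I" for j using insert.prems(1) that by simp
    fix x g assume xg: "\<And>j. j \<in> I \<Longrightarrow> G j (x j) = ereal (g j)"
    have ne: "j \<noteq> i" if "j \<in> I" for j using that insert.hyps by auto
    have "(\<Sum>j\<in>insert i I. blinfun_apply (\<phi> j) ((x(i := y)) j) - (g(i := h)) j) \<le> B"
      using y xg ne by (intro insert.prems(2)) auto
    moreover have "(\<Sum>j\<in>I. blinfun_apply (\<phi> j) ((x(i := y)) j) - (g(i := h)) j) =
        (\<Sum>j\<in>I. blinfun_apply (\<phi> j) (x j) - g j)"
      using ne by (intro sum.cong) auto
    ultimately show "(\<Sum>j\<in>I. blinfun_apply (\<phi> j) (x j) - g j) \<le> B - (blinfun_apply (\<phi> i) y - h)"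
      using insert.hyps by simp
  qed
  obtain y0 where "G i y0 \<noteq> \<infinity>" "G i y0 \<noteq> -\<infinity>" using insert.prems(1)[of i] by (auto simp: proper_convex_def)
  then obtain h0 where "G i y0 = ereal h0" by (cases "G i y0") auto
  then have "(\<Sum>j\<in>I. conjugate (G j) (\<phi> j)) \<noteq> \<infinity>" using step by fastforce
  moreover have "conjugate (G j) (\<phi> j) \<noteq> -\<infinity>" if "j \<in> I" for j
    using insert.prems(1) that by (intro conjugate_not_MInf) auto
  ultimately obtain c where c: "(\<Sum>j\<in>I. conjugate (G j) (\<phi> j)) = ereal (\<Sum>j\<in>I. c j)"
    using sum_ereal_finite_cases[OF insert.hyps(1), of "\<lambda>j. conjugate (G j) (\<phi> j)"] by blast
  have "conjugate (G i) (\<phi> i) \<le> ereal (B - (\<Sum>j\<in>I. c j))"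
    unfolding conjugate_def
  proof (rule SUP_least)
    fix y
    have "G i y \<noteq> -\<infinity>" using insert.prems(1)[of i] by (auto simp: proper_convex_def)
    then show "ereal (blinfun_apply (\<phi> i) y) - G i y \<le> ereal (B - (\<Sum>j\<in>I. c j))"
    proof (cases "G i y")
      case (real h)
      then show ?thesis using step[OF real] by (simp add: c)
    qed auto
  qed
  then have "conjugate (G i) (\<phi> i) + ereal (\<Sum>j\<in>I. c j) \<le> ereal (B - (\<Sum>j\<in>I. c j)) + ereal (\<Sum>j\<in>I. c j)"
    by (rule add_right_mono)
  then show ?case using insert.hyps by (simp add: c)
qed

section \<open>Subgradients of the value function\<close>

text \<open>The epigraph of the value of (A) as a function of the perturbation \<open>w\<close>, where \<open>u\<close> is replaced
  by \<open>u + w \<psi>\<close>: the pairs \<open>(w, g)\<close> such that \<open>g\<close> is an upper bound of the objective at some point that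
  is feasible for the perturbed problem.\<close>

definition epigraph_A ::
    "nat \<Rightarrow> (nat \<Rightarrow> 'a::euclidean_space lgfun \<Rightarrow> ereal) \<Rightarrow> ((nat \<Rightarrow> 'a) \<Rightarrow> real) \<Rightarrow>
     (((nat \<Rightarrow> 'a) \<Rightarrow>\<^sub>C real) \<times> real) set" where
  "epigraph_A T G u = {(w, g). \<exists>x. \<exists>z \<in> trading_strategies T.
     constraint_A T (\<lambda>s. u s + apply_bcontfun w s * psi T s) x z \<and> (\<Sum>t\<le>T. G t (x t)) \<le> ereal g}"

lemma epigraph_AI:
  assumes "z \<in> trading_strategies T" "(\<Sum>t\<le>T. G t (x t)) \<le> ereal g"
    and "\<And>s. s \<in> paths T \<Longrightarrow> u s + apply_bcontfun w s * psi T s \<le> gain T z s + (\<Sum>t\<le>T. apply_lgfun (x t) (s t))"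
  shows "(w, g) \<in> epigraph_A T G u"
  using assms unfolding epigraph_A_def constraint_A_def by blast

lemma convex_epigraph_A:
  fixes G :: "nat \<Rightarrow> 'a::euclidean_space lgfun \<Rightarrow> ereal"
  assumes G: "\<And>t. t \<le> T \<Longrightarrow> proper_convex (G t)"
  shows "convex (epigraph_A T G u)"
proof (rule convexI)
  fix p1 p2 :: "((nat \<Rightarrow> 'a) \<Rightarrow>\<^sub>C real) \<times> real" and a b :: real
  assume p: "p1 \<in> epigraph_A T G u" "p2 \<in> epigraph_A T G u" and ab: "0 \<le> a" "0 \<le> b" "a + b = 1"
  show "a *\<^sub>R p1 + b *\<^sub>R p2 \<in> epigraph_A T G u"
  proof (cases "a = 0 \<or> b = 0")
    case True
    then show ?thesis using p ab by auto
  next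
    case False
    then have a: "0 < a" "0 < b" "b = 1 - a" "a < 1" using ab by auto
    obtain w1 g1 w2 g2 where pw: "p1 = (w1, g1)" "p2 = (w2, g2)" by (metis surj_pair)
    obtain x1 z1 where 1: "z1 \<in> trading_strategies T" "(\<Sum>t\<le>T. G t (x1 t)) \<le> ereal g1"
      "\<And>s. s \<in> paths T \<Longrightarrow> u s + w1 s * psi T s \<le> gain T z1 s + (\<Sum>t\<le>T. apply_lgfun (x1 t) (s t))"
      using p(1) unfolding pw epigraph_A_def constraint_A_def by blast
    obtain x2 z2 where 2: "z2 \<in> trading_strategies T" "(\<Sum>t\<le>T. G t (x2 t)) \<le> ereal g2"
      "\<And>s. s \<in> paths T \<Longrightarrow> u s + w2 s * psi T s \<le> gain T z2 s + (\<Sum>t\<le>T. apply_lgfun (x2 t) (s t))"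
      using p(2) unfolding pw epigraph_A_def constraint_A_def by blast
    have not_MInf: "G t y \<noteq> -\<infinity>" if "t \<in> {..T}" for t y using G that by (auto simp: proper_convex_def)
    obtain h1 where h1: "\<And>t. t \<in> {..T} \<Longrightarrow> G t (x1 t) = ereal (h1 t)"
      "(\<Sum>t\<le>T. G t (x1 t)) = ereal (\<Sum>t\<le>T. h1 t)"
      by (rule sum_ereal_finite_cases[of "{..T}" "\<lambda>t. G t (x1 t)"]) (use not_MInf 1(2) in auto)
    obtain h2 where h2: "\<And>t. t \<in> {..T} \<Longrightarrow> G t (x2 t) = ereal (h2 t)"
      "(\<Sum>t\<le>T. G t (x2 t)) = ereal (\<Sum>t\<le>T. h2 t)"
      by (rule sum_ereal_finite_cases[of "{..T}" "\<lambda>t. G t (x2 t)"]) (use not_MInf 2(2) in auto)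
    define x where "x t = a *\<^sub>R x1 t + b *\<^sub>R x2 t" for t
    define z where "z = (\<lambda>t p. a *\<^sub>R z1 t p + b *\<^sub>R z2 t p)"
    have "(\<Sum>t\<le>T. G t (x t)) \<le> (\<Sum>t\<le>T. ereal (a * h1 t + b * h2 t))"
    proof (rule sum_mono)
      fix t assume t: "t \<in> {..T}"
      then have "G t (x t) \<le> ereal a * G t (x1 t) + ereal b * G t (x2 t)"
        using G[of t] a unfolding proper_convex_def x_def by auto
      then show "G t (x t) \<le> ereal (a * h1 t + b * h2 t)" using h1(1)[OF t] h2(1)[OF t] by simp
    qed
    also have "\<dots> = ereal (a * (\<Sum>t\<le>T. h1 t) + b * (\<Sum>t\<le>T. h2 t))"
      by (simp add: sum.distrib sum_distrib_left)
    also have "\<dots> \<le> ereal (a * g1 + b * g2)"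
      using 1(2) 2(2) ab unfolding h1(2) h2(2) by (auto intro!: add_mono mult_left_mono)
    finally have Gx: "(\<Sum>t\<le>T. G t (x t)) \<le> ereal (a * g1 + b * g2)" .
    have "(a *\<^sub>R w1 + b *\<^sub>R w2, a * g1 + b * g2) \<in> epigraph_A T G u"
    proof (rule epigraph_AI[of z T G x, OF _ Gx])
      show "z \<in> trading_strategies T" unfolding z_def by (rule trading_strategies_comb[OF 1(1) 2(1)])
      fix s :: "nat \<Rightarrow> 'a" assume s: "s \<in> paths T"
      have "a * (u s + w1 s * psi T s) + b * (u s + w2 s * psi T s) \<le>
          a * (gain T z1 s + (\<Sum>t\<le>T. apply_lgfun (x1 t) (s t))) +
          b * (gain T z2 s + (\<Sum>t\<le>T. apply_lgfun (x2 t) (s t)))"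
        by (rule add_mono[OF mult_left_mono[OF 1(3)[OF s] ab(1)] mult_left_mono[OF 2(3)[OF s] ab(2)]])
      also have "\<dots> = gain T z s + (\<Sum>t\<le>T. apply_lgfun (x t) (s t))"
        by (simp add: z_def gain_comb x_def sum.distrib sum_distrib_left algebra_simps)
      also have "a * (u s + w1 s * psi T s) + b * (u s + w2 s * psi T s) =
          u s + (a *\<^sub>R w1 + b *\<^sub>R w2) s * psi T s"
        by (simp add: a(3) algebra_simps)
      finally show "u s + (a *\<^sub>R w1 + b *\<^sub>R w2) s * psi T s \<le>
          gain T z s + (\<Sum>t\<le>T. apply_lgfun (x t) (s t))" .
    qed
    then show ?thesis by (simp add: pw)
  qed
qed

lemma nonpos_if_multiples_bounded:
  fixes a b :: real
  assumes "\<And>n :: nat. real n * a \<le> b"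
  shows "a \<le> 0"
proof (rule ccontr)
  assume "\<not> a \<le> 0"
  then have a: "a > 0" by simp
  obtain n :: nat where "b / a < real n" using reals_Archimedean2 by blast
  then have "b < real n * a" using a by (simp add: pos_divide_less_eq)
  then show False using assms[of n] by simp
qed

text \<open>The heart of the matter, for a finite value of (A). The functional \<open>L\<close> is a subgradient of the
  value function at the unperturbed problem, and the measure that solves (B) represents it.\<close>

theorem dual_solution_exists:
  fixes G :: "nat \<Rightarrow> 'a::euclidean_space lgfun \<Rightarrow> ereal"
  assumes G: "\<And>t. t \<le> T \<Longrightarrow> proper_convex (G t)"
    and u: "usc_on_paths T u"
    and dom: "\<And>t. t \<le> T \<Longrightarrow> edom (conjugate (G t)) \<subseteq> measure_functionals"
    and K: "\<And>s. s \<in> paths T \<Longrightarrow> u s \<le> K * psi T s"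
    and \<epsilon>: "\<epsilon> > 0" and feas: "feasible_A T G (\<lambda>s. u s + \<epsilon> * psi T s)"
    and \<alpha>: "value_A T G u = ereal \<alpha>"
  obtains \<mu> where "\<mu> \<in> martingale_measures T" "objective_B T G u \<mu> \<le> ereal (- \<alpha>)"
proof -
  let ?P = "epigraph_A T G u"
  have not_MInf: "G t y \<noteq> -\<infinity>" if "t \<in> {..T}" for t y using G that by (auto simp: proper_convex_def)
  obtain x0 z0 where x0: "\<And>t. t \<le> T \<Longrightarrow> G t (x0 t) < \<infinity>" and z0: "z0 \<in> trading_strategies T"
    and con0: "\<And>s. s \<in> paths T \<Longrightarrow> u s + \<epsilon> * psi T s \<le> gain T z0 s + (\<Sum>t\<le>T. apply_lgfun (x0 t) (s t))"
    using feas unfolding feasible_A_def constraint_A_def edom_def by blast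
  have fin0: "(\<Sum>t\<le>T. G t (x0 t)) \<noteq> \<infinity>" using x0 by (auto simp: sum_Pinfty)
  obtain g0 where "\<And>t. t \<in> {..T} \<Longrightarrow> G t (x0 t) = ereal (g0 t)"
    and g0: "(\<Sum>t\<le>T. G t (x0 t)) = ereal (\<Sum>t\<le>T. g0 t)"
    by (rule sum_ereal_finite_cases[of "{..T}" "\<lambda>t. G t (x0 t)"]) (use not_MInf fin0 in auto)
  define c0 where "c0 = (\<Sum>t\<le>T. g0 t)"
  have c0: "(\<Sum>t\<le>T. G t (x0 t)) = ereal c0" by (simp only: g0 c0_def)
  have P0: "(w, c0) \<in> ?P" if w: "\<And>s. s \<in> paths T \<Longrightarrow> apply_bcontfun w s \<le> \<epsilon>" for w :: "(nat \<Rightarrow> 'a) \<Rightarrow>\<^sub>C real"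
  proof (rule epigraph_AI[of z0 T G x0, OF z0])
    fix s :: "nat \<Rightarrow> 'a" assume s: "s \<in> paths T"
    have "w s * psi T s \<le> \<epsilon> * psi T s" using w[OF s] by (intro mult_right_mono) auto
    then show "u s + w s * psi T s \<le> gain T z0 s + (\<Sum>t\<le>T. apply_lgfun (x0 t) (s t))"
      using con0[OF s] by linarith
  qed (simp add: c0)
  have "\<exists>L. linear L \<and> (\<forall>w g. (w, g) \<in> ?P \<longrightarrow> \<alpha> + L w \<le> g)"
  proof (rule algebraic_subgradient)
    show "convex ?P" by (rule convex_epigraph_A[OF G])
    fix w :: "(nat \<Rightarrow> 'a) \<Rightarrow>\<^sub>C real"
    \<comment> \<open>The strengthened feasibility admits all perturbations bounded by \<open>\<epsilon>\<close>.\<close>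
    define \<tau> where "\<tau> = \<epsilon> / (1 + norm w)"
    have n: "0 < 1 + norm w" by (simp add: add_pos_nonneg)
    have \<tau>: "\<tau> > 0" using \<epsilon> n by (simp add: \<tau>_def)
    have "(\<tau> *\<^sub>R w, c0) \<in> ?P"
    proof (rule P0)
      fix s :: "nat \<Rightarrow> 'a"
      have "w s \<le> 1 + norm w" using norm_bounded[of w s] by simp
      then have "\<tau> * w s \<le> \<tau> * (1 + norm w)" using \<tau> by (intro mult_left_mono) auto
      also have "\<dots> = \<epsilon>" using n by (simp add: \<tau>_def)
      finally show "(\<tau> *\<^sub>R w) s \<le> \<epsilon>" by simp
    qed
    then show "\<exists>\<tau>>0. \<exists>g. (\<tau> *\<^sub>R w, g) \<in> ?P" using \<tau> by blast
  next
    fix g assume "(0, g) \<in> ?P"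
    then obtain x z where "z \<in> trading_strategies T" "constraint_A T u x z"
      and g: "(\<Sum>t\<le>T. G t (x t)) \<le> ereal g" by (auto simp: epigraph_A_def)
    then have "value_A T G u \<le> (\<Sum>t\<le>T. G t (x t))"
      unfolding value_A_def by (intro Inf_lower) blast
    with g have "ereal \<alpha> \<le> ereal g" unfolding \<alpha> by (rule order_trans[rotated])
    then show "\<alpha> \<le> g" by simp
  qed
  then obtain L where lin: "linear L" and sub: "\<And>w g. (w, g) \<in> ?P \<Longrightarrow> \<alpha> + L w \<le> g" by blast
  note L_simps = linear_add[OF lin] linear_diff[OF lin] linear_sum[OF lin] linear_scale[OF lin]
    linear_neg[OF lin]
  have pos: "0 \<le> L w" if w: "\<And>s. s \<in> paths T \<Longrightarrow> 0 \<le> apply_bcontfun w s" for w :: "(nat \<Rightarrow> 'a) \<Rightarrow>\<^sub>C real"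
  proof -
    \<comment> \<open>Lowering \<open>u\<close> preserves feasibility of the point \<open>x0, z0\<close>, by however large a multiple.\<close>
    have "real n * (- L w) \<le> c0 - \<alpha>" for n
    proof -
      have "((- real n) *\<^sub>R w, c0) \<in> ?P"
      proof (rule P0)
        fix s :: "nat \<Rightarrow> 'a" assume "s \<in> paths T"
        then have "0 \<le> real n * w s" using w by simp
        then show "((- real n) *\<^sub>R w) s \<le> \<epsilon>" using \<epsilon> by simp
      qed
      from sub[OF this] show ?thesis by (simp add: L_simps)
    qed
    then have "- L w \<le> 0" by (rule nonpos_if_multiples_bounded)
    then show ?thesis by simp
  qed
  \<comment> \<open>The largest admissible perturbation is \<open>(gain + \<Sum>x\<^sub>t - u) / \<psi>\<close>. It is only lower semicontinuous,
    so \<open>- u / \<psi>\<close> is replaced by a continuous \<open>v\<close> below it.\<close>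
  have main: "\<alpha> + (L v + L \<gamma> + (\<Sum>t\<le>T. L (coord T t (x t)))) \<le> g"
    if z: "z \<in> trading_strategies T" and \<gamma>: "\<And>s. apply_bcontfun \<gamma> s = gain T z s / psi T s"
      and g: "(\<Sum>t\<le>T. G t (x t)) \<le> ereal g"
      and v: "\<And>s. s \<in> paths T \<Longrightarrow> apply_bcontfun v s * psi T s \<le> - u s" for v \<gamma> :: "(nat \<Rightarrow> 'a) \<Rightarrow>\<^sub>C real" and x z g
  proof -
    have "(v + \<gamma> + (\<Sum>t\<le>T. coord T t (x t)), g) \<in> ?P"
    proof (rule epigraph_AI[of z T G x g, OF z g])
      fix s :: "nat \<Rightarrow> 'a" assume s: "s \<in> paths T"
      have "(v + \<gamma> + (\<Sum>t\<le>T. coord T t (x t))) s * psi T s =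
          v s * psi T s + gain T z s + (\<Sum>t\<le>T. apply_lgfun (x t) (s t))"
        by (simp add: \<gamma> sum_apply_bcontfun apply_coord distrib_right sum_distrib_right)
      then show "u s + (v + \<gamma> + (\<Sum>t\<le>T. coord T t (x t))) s * psi T s \<le>
          gain T z s + (\<Sum>t\<le>T. apply_lgfun (x t) (s t))"
        using v[OF s] by simp
    qed
    from sub[OF this] show ?thesis by (simp add: L_simps)
  qed
  have vK: "const_bcontfun (- K) s * psi T s \<le> - u s" if "s \<in> paths T" for s
    using K[OF that] by simp
  \<comment> \<open>The strategies can be scaled by any real \<open>c\<close>, so \<open>L\<close> must vanish on their gains.\<close>
  have mart: "L (gain_bcont T t f e) = 0" if t: "t < T" for t f and e :: 'a
  proof -
    have bnd: "c * L (gain_bcont T t f e) \<le>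
        c0 - \<alpha> - L (const_bcontfun (- K)) - (\<Sum>t\<le>T. L (coord T t (x0 t)))" for c
    proof -
      have \<gamma>: "(c *\<^sub>R gain_bcont T t f e) s = gain T (hold t f e c) s / psi T s" for s
        by (simp add: apply_gain_bcont[OF t] gain_hold[OF t])
      from main[OF hold_trading \<gamma> eq_refl[OF c0] vK]
      show ?thesis by (simp add: L_simps)
    qed
    have "L (gain_bcont T t f e) \<le> 0" using bnd by (rule nonpos_if_multiples_bounded)
    moreover have "- L (gain_bcont T t f e) \<le> 0"
      using bnd[of "- real _"] by (intro nonpos_if_multiples_bounded) simp
    ultimately show ?thesis by simp
  qed
  \<comment> \<open>The marginals of \<open>L\<close>, so far as elements of the dual of \<open>C\<^sub>t\<close>; they turn out to lie in the domain
    of the conjugate and hence to be measures.\<close>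
  define \<phi> where "\<phi> t = Blinfun (\<lambda>x. L (coord T t x))" for t
  have \<phi>: "blinfun_apply (\<phi> t) x = L (coord T t x)" if t: "t \<le> T" for t x
  proof -
    have "bounded_linear (\<lambda>x. L (coord T t x))"
    proof (rule bounded_linear_intro[where K = "L (const_bcontfun 1)"])
      fix x y :: "'a lgfun" and c :: real
      have "coord T t (x + y) = coord T t x + coord T t y" "coord T t (c *\<^sub>R x) = c *\<^sub>R coord T t x"
        by (rule bcontfun_eqI, simp add: apply_coord[OF t] add_divide_distrib)+
      then show "L (coord T t (x + y)) = L (coord T t x) + L (coord T t y)"
        "L (coord T t (c *\<^sub>R x)) = c *\<^sub>R L (coord T t x)" by (simp_all add: L_simps)
      have "apply_bcontfun (coord T t x) s \<le> norm x" "0 \<le> norm x + apply_bcontfun (coord T t x) s" for s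
        using abs_lgfun_over_psi_le[OF t, of x s] unfolding apply_coord[OF t] by linarith+
      then have "0 \<le> L (norm x *\<^sub>R const_bcontfun 1 - coord T t x)"
        "0 \<le> L (norm x *\<^sub>R const_bcontfun 1 + coord T t x)"
        by (auto intro!: pos)
      then show "norm (L (coord T t x)) \<le> norm x * L (const_bcontfun 1)" by (simp add: L_simps)
    qed
    then show ?thesis by (simp add: \<phi>_def bounded_linear_Blinfun_apply)
  qed
  have conj_le: "(\<Sum>t\<le>T. conjugate (G t) (\<phi> t)) \<le> ereal (- \<alpha> - L v)"
    if v: "\<And>s. s \<in> paths T \<Longrightarrow> apply_bcontfun v s * psi T s \<le> - u s" for v :: "(nat \<Rightarrow> 'a) \<Rightarrow>\<^sub>C real"
  proof (rule conjugate_sum_le)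
    fix x g assume xg: "\<And>t. t \<in> {..T} \<Longrightarrow> G t (x t) = ereal (g t)"
    have z: "(\<lambda>_ _. 0) \<in> trading_strategies T" by (auto simp: trading_strategies_def bounded_iff)
    have \<gamma>: "apply_bcontfun 0 s = gain T (\<lambda>_ _. 0) s / psi T s" for s :: "nat \<Rightarrow> 'a" by (simp add: gain_def)
    have "(\<Sum>t\<le>T. G t (x t)) \<le> ereal (\<Sum>t\<le>T. g t)" using xg by simp
    from main[OF z \<gamma> this v]
    have "\<alpha> + (L v + (\<Sum>t\<le>T. L (coord T t (x t)))) \<le> (\<Sum>t\<le>T. g t)"
      using linear_0[OF lin] by simp
    then show "(\<Sum>t\<le>T. blinfun_apply (\<phi> t) (x t) - g t) \<le> - \<alpha> - L v"
      by (simp add: \<phi> sum_subtractf)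
  qed (use G in auto)
  have conj_MInf: "conjugate (G t) (\<phi> t) \<noteq> -\<infinity>" if "t \<in> {..T}" for t
    using G that by (intro conjugate_not_MInf) auto
  have fin_conj: "(\<Sum>t\<le>T. conjugate (G t) (\<phi> t)) \<noteq> \<infinity>" using conj_le[OF vK] by auto
  obtain c where c: "\<And>t. t \<in> {..T} \<Longrightarrow> conjugate (G t) (\<phi> t) = ereal (c t)"
    "(\<Sum>t\<le>T. conjugate (G t) (\<phi> t)) = ereal (\<Sum>t\<le>T. c t)"
    by (rule sum_ereal_finite_cases[of "{..T}" "\<lambda>t. conjugate (G t) (\<phi> t)"])
      (use conj_MInf fin_conj in auto)
  have meas: "\<phi> t \<in> measure_functionals" if "t \<le> T" for t
    using dom[OF that] c(1)[of t] that by (auto simp: edom_def)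
  interpret daniell_functional L
    by (rule daniell_functionalI_tight[of L T \<phi>]) (use lin pos \<phi> meas in auto)
  define \<mu> where "\<mu> = path_measure T riesz"
  have \<mu>: "\<mu> \<in> nonneg_measures T"
    unfolding \<mu>_def by (rule path_measure_nonneg) (simp_all add: riesz.finite_measure_axioms)
  note int\<mu> = path_measure_integral[OF sets_riesz, where T = T, folded \<mu>_def]
  have mm: "\<mu> \<in> martingale_measures T"
  proof (rule martingale_measuresI[OF \<mu>])
    fix t f and e :: 'a assume t: "t < T"
    have "(LINT s|\<mu>. gain T (hold t f e 1) s) = (LINT s|riesz. gain_bcont T t f e s)"
      by (subst int\<mu>(2)[OF borel_measurable_gain[OF hold_trading]], rule Bochner_Integration.integral_cong)
        (simp_all add: apply_gain_bcont[OF t])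
    also have "\<dots> = 0" using mart[OF t] by (simp flip: J_eq_integral)
    finally show "(LINT s|\<mu>. gain T (hold t f e 1) s) = 0" .
  qed
  have marg: "integral_functional (marginal \<mu> t) = \<phi> t" if t: "t \<le> T" for t
  proof (rule blinfun_eqI)
    fix x :: "'a lgfun"
    have m: "(\<lambda>s. apply_lgfun x (s t)) \<in> borel_measurable (path_borel T)"
      using t by (intro measurable_compose[OF measurable_path_component]) auto
    have "blinfun_apply (integral_functional (marginal \<mu> t)) x = (LINT s|riesz. coord T t x s)"
      unfolding marginal_facts(3)[OF \<mu> t] int\<mu>(2)[OF m]
      by (rule Bochner_Integration.integral_cong) (use t in \<open>simp_all add: apply_coord\<close>)
    then show "blinfun_apply (integral_functional (marginal \<mu> t)) x = blinfun_apply (\<phi> t) x"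
      using t by (simp add: \<phi> J_eq_integral)
  qed
  \<comment> \<open>Letting \<open>v\<close> increase to \<open>- u / \<psi>\<close>, monotone convergence shows that \<open>u\<close> is integrable and
    replaces \<open>L v\<close> by the integral of \<open>- u\<close>.\<close>
  define h where "h s = - u (restrict s {..T}) / psi T s" for s
  have hK: "- K \<le> h s" for s
    using K[of "restrict s {..T}"] by (simp add: h_def pos_divide_le_eq)
  have hlsc: "open {s. a < h s}" for a unfolding h_def by (rule lsc_rescaled[OF u])
  obtain v where v: "\<And>n s. apply_bcontfun (v n) s \<le> apply_bcontfun (v (Suc n)) s"
    "\<And>n s. apply_bcontfun (v n) s \<le> h s" "\<And>s. (\<lambda>n. apply_bcontfun (v n) s) \<longlonglongrightarrow> h s"
    by (rule lsc_approx[OF hlsc hK]) blast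
  define B where "B = - \<alpha> - (\<Sum>t\<le>T. c t)"
  have vB: "(LINT s|riesz. v n s) \<le> B" for n
  proof -
    have "v n s * psi T s \<le> - u s" if "s \<in> paths T" for s
      using v(2)[of n s] that pos_le_divide_eq[OF psi_pos[of T s], of "v n s" "- u s"]
      by (simp add: h_def)
    from conj_le[OF this] show ?thesis
      by (simp add: c(2) B_def flip: J_eq_integral)
  qed
  have "mono (\<lambda>n. LINT s|riesz. v n s)"
    unfolding mono_iff_le_Suc by (intro allI integral_mono integrable_riesz v(1))
  then obtain l where l: "(\<lambda>n. LINT s|riesz. v n s) \<longlonglongrightarrow> l"
    using incseq_convergent[of "\<lambda>n. LINT s|riesz. v n s" B] vB by blast
  have um: "u \<in> borel_measurable (path_borel T)" by (rule borel_measurable_usc[OF u])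
  have hm: "h \<in> borel_measurable borel"
    unfolding h_def using borel_measurable_restrict[OF um] by measurable
  have hl: "has_bochner_integral riesz h l"
  proof (rule has_bochner_integral_monotone_convergence[OF _ _ _ l])
    show "AE s in riesz. mono (\<lambda>n. v n s)" using v(1) by (simp add: mono_iff_le_Suc)
  qed (use integrable_riesz v(3) hm in auto)
  have lB: "l \<le> B" using l vB by (intro LIMSEQ_le_const2) auto
  have hneg: "(\<lambda>s. u (restrict s {..T}) / psi T s) = (\<lambda>s. - h s)" by (simp add: h_def)
  have "integrable \<mu> u"
    unfolding int\<mu>(1)[OF um] hneg using hl by (simp add: has_bochner_integral_iff)
  moreover have "(LINT s|\<mu>. u s) = - l"
    unfolding int\<mu>(2)[OF um] hneg using hl by (simp add: has_bochner_integral_iff)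
  ultimately have "ext_integral \<mu> u = ereal (- l)" by (simp add: ext_integral_integrable)
  moreover have "(\<Sum>t\<le>T. conjugate (G t) (integral_functional (marginal \<mu> t))) = ereal (\<Sum>t\<le>T. c t)"
    unfolding c(2)[symmetric] by (intro sum.cong refl) (simp add: marg)
  ultimately have "objective_B T G u \<mu> \<le> ereal (- \<alpha>)"
    using lB by (simp add: objective_B_def B_def)
  with mm show ?thesis by (rule that)
qed

section \<open>Strong duality\<close>

theorem theorem7:
  fixes T :: nat
    and G :: "nat \<Rightarrow> (real ^ 'n) lgfun \<Rightarrow> ereal"
    and u :: "(nat \<Rightarrow> real ^ 'n) \<Rightarrow> real"
    and K \<epsilon> :: real
  assumes "\<And>t. t \<le> T \<Longrightarrow> proper_convex (G t)"
    and "usc_on_paths T u"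
    and "\<And>t. t \<le> T \<Longrightarrow> edom (conjugate (G t)) \<subseteq> measure_functionals"
    and "\<And>s. s \<in> paths T \<Longrightarrow> u s \<le> K * psi T s"
    and "\<epsilon> > 0"
    and "feasible_A T G (\<lambda>s. u s + \<epsilon> * psi T s)"
  shows "(\<exists>\<mu> \<in> martingale_measures T. objective_B T G u \<mu> = value_B T G u) \<and>
         value_B T G u = - value_A T G u"
proof -
  have "\<exists>\<mu>\<in>martingale_measures T. objective_B T G u \<mu> \<le> - value_A T G u"
  proof (cases "value_A T G u")
    case (real \<alpha>)
    obtain \<mu> where "\<mu> \<in> martingale_measures T" "objective_B T G u \<mu> \<le> ereal (- \<alpha>)"
      by (rule dual_solution_exists[OF assms real])
    then show ?thesis by (auto simp: real)
  next
    case PInf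
    obtain x z where x: "\<And>t. t \<le> T \<Longrightarrow> G t (x t) < \<infinity>" and z: "z \<in> trading_strategies T"
      and con: "\<And>s. s \<in> paths T \<Longrightarrow> u s + \<epsilon> * psi T s \<le> gain T z s + (\<Sum>t\<le>T. apply_lgfun (x t) (s t))"
      using assms(6) unfolding feasible_A_def constraint_A_def edom_def by blast
    have "constraint_A T u x z"
      unfolding constraint_A_def
    proof
      fix s :: "nat \<Rightarrow> real ^ 'n" assume s: "s \<in> paths T"
      have "0 \<le> \<epsilon> * psi T s" using assms(5) by simp
      then show "u s \<le> gain T z s + (\<Sum>t\<le>T. apply_lgfun (x t) (s t))" using con[OF s] by linarith
    qed
    then have "value_A T G u \<le> (\<Sum>t\<le>T. G t (x t))"
      unfolding value_A_def using z by (intro Inf_lower) blast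
    moreover have "(\<Sum>t\<le>T. G t (x t)) \<noteq> \<infinity>" using x by (auto simp: sum_Pinfty)
    ultimately show ?thesis using PInf by simp
  next
    case MInf
    \<comment> \<open>Every martingale measure has objective value \<open>\<infinity>\<close>, so any one will do.\<close>
    have "null_measure (path_borel T) \<in> martingale_measures T"
      by (auto simp: martingale_measures_def nonneg_measures_def finite_measureI)
    then show ?thesis using MInf by auto
  qed
  then obtain \<mu> where \<mu>: "\<mu> \<in> martingale_measures T" "objective_B T G u \<mu> \<le> - value_A T G u" by blast
  have "value_B T G u \<le> objective_B T G u \<mu>" unfolding value_B_def using \<mu>(1) by (rule INF_lower)
  moreover have "- value_A T G u \<le> value_B T G u"
    unfolding value_B_def by (intro INF_greatest weak_duality assms(1))
  ultimately show ?thesis using \<mu> by (intro conjI bexI[of _ \<mu>] antisym) auto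
qed

end
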